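(* Let $m\ge 2$ and $k\in\{1,\dots,m-1\}$ be integers. Let $\varphi\in C^{\infty}(\mathbb{P}_m\mathbb{C})$ be a $g$-admissible and $G$-invariant function with $\sup_{\mathbb{P}_m\mathbb{C}}\varphi=0$. Then $\varphi\ge\psi$ on $\mathbb{P}_m\mathbb{C}$.
   Context: $\mathbb{P}_m\mathbb{C}$ is complex projective space of complex dimension $m$, with homogeneous coordinates $[z_0,\dots,z_m]$. Write $\partial_{\lambda\bar\mu}=\frac{\partial^2}{\partial z_\lambda\partial\bar z_\mu}$. Metric: $g$ is the Kähler metric on $\mathbb{P}_m\mathbb{C}$ with components, in the chart $\{z_0\ne0\}$ (normalised by $z_0=1$), $g_{\lambda\bar\mu}=(m+1)\,\partial_{\lambda\bar\mu}\ln(1+|z_1|^2+\dots+|z_m|^2)$. A real function $\varphi\in C^\infty(\mathbb{P}_m\mathbb{C})$ is $g$-admissible if the Hermitian matrix $(g_{\lambda\bar\mu}+\partial_{\lambda\bar\mu}\varphi)$ is positive definite at every point of $\mathbb{P}_m\mathbb{C}$. Group: $G$ is the group of automorphisms of $\mathbb{P}_m\mathbb{C}$ generated by: the $\sigma_{i,j}$ for $i,j\in\{0,\dots,k\}$, exchanging the homogeneous coordinates $z_i$ and $z_j$; the $\varphi_{p,q}$ for $p,q\in\{k+1,\dots,m\}$, exchanging $z_p$ and $z_q$; and the $\tau_{l,\theta}$ for $l\in\{0,\dots,m\}$, $\theta\in[0,2\pi]$, replacing $z_l$ by $z_le^{i\theta}$. The function $\psi=\inf(\psi_1,\psi_2)$,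 with $$\psi_1=\ln\frac{(|z_0|\cdots|z_k|)^{2(m+1)/(k+1)}}{(|z_0|^2+\dots+|z_m|^2)^{m+1}},\qquad \psi_2=\ln\frac{(|z_{k+1}|\cdots|z_m|)^{2(m+1)/(m-k)}}{(|z_0|^2+\dots+|z_m|^2)^{m+1}}.$$ These are homogeneous of degree zero and so define functions on $\mathbb{P}_m\mathbb{C}$ (finite where no homogeneous coordinate vanishes; with the convention $\ln 0=-\infty$, $\psi=-\infty$ where some $z_p=0$). *)

theory Defs
  imports "HOL-Analysis.Analysis" "HOL-Algebra.Bij" "HOL-Algebra.Generated_Groups"
    "HOL-Combinatorics.Transposition"
begin

section \<open>Complex projective space\<close>

text \<open>Vectors of \<open>\<complex>\<^sup>m\<^sup>+\<^sup>1\<close> are functions on the naturals that vanish beyond \<open>m\<close>.\<close>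

definition hvec :: "nat \<Rightarrow> (nat \<Rightarrow> complex) set" where
  "hvec m = {z. (\<forall>i>m. z i = 0) \<and> (\<exists>i\<le>m. z i \<noteq> 0)}"

definition proj_rel :: "nat \<Rightarrow> ((nat \<Rightarrow> complex) \<times> (nat \<Rightarrow> complex)) set" where
  "proj_rel m = {(z, w). z \<in> hvec m \<and> w \<in> hvec m \<and> (\<exists>c. c \<noteq> 0 \<and> w = (\<lambda>i. c * z i))}"

definition CP :: "nat \<Rightarrow> (nat \<Rightarrow> complex) set set" where
  "CP m = hvec m // proj_rel m"

definition hpoint :: "nat \<Rightarrow> (nat \<Rightarrow> complex) \<Rightarrow> (nat \<Rightarrow> complex) set" where
  "hpoint m z = proj_rel m `` {z}"

text \<open>The inverse of the affine chart of \<open>{z\<^sub>i \<noteq> 0}\<close>, normalised by \<open>z\<^sub>i = 1\<close>.  The affine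
  coordinates are the \<open>w j\<close> with \<open>j \<in> {..m} - {i}\<close>; all other values of \<open>w\<close> are
  ignored, so that \<^term>\<open>UNIV\<close> can serve as the domain of the chart map.\<close>

definition chart_pt :: "nat \<Rightarrow> nat \<Rightarrow> (nat \<Rightarrow> complex) \<Rightarrow> (nat \<Rightarrow> complex) set" where
  "chart_pt m i w = hpoint m (\<lambda>j. if j = i then 1 else if j \<le> m then w j else 0)"

section \<open>Partial derivatives and smooth functions\<close>

text \<open>The real directional derivative in the \<open>j\<close>-th complex variable, in the direction \<open>c\<close>:
  for \<open>c = 1\<close> it is \<open>\<partial>/\<partial>x\<^sub>j\<close> and for \<open>c = \<i>\<close> it is \<open>\<partial>/\<partial>y\<^sub>j\<close>.\<close>

definition pdiff :: "complex \<Rightarrow> nat \<Rightarrow> ((nat \<Rightarrow> complex) \<Rightarrow> 'b::real_normed_vector) \<Rightarrow> (nat \<Rightarrow> complex) \<Rightarrow> 'b" where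
  "pdiff c j F w = vector_derivative (\<lambda>t::real. F (w(j := w j + of_real t * c))) (at 0)"

text \<open>Functions of class \<open>C\<^sup>r\<close> in the variables indexed by \<open>J\<close>, meant for functions that depend on
  these finitely many variables only; for them continuity in the product topology is
  continuity on \<open>\<complex>\<^sup>J\<close>.\<close>

primrec Cr :: "nat \<Rightarrow> nat set \<Rightarrow> ((nat \<Rightarrow> complex) \<Rightarrow> 'b::real_normed_vector) \<Rightarrow> bool" where
  "Cr 0 J F \<longleftrightarrow> continuous_on UNIV F"
| "Cr (Suc r) J F \<longleftrightarrow> continuous_on UNIV F \<and>
     (\<forall>j\<in>J. \<forall>c\<in>{1, \<i>}.
        (\<forall>w. (\<lambda>t::real. F (w(j := w j + of_real t * c))) differentiable at 0) \<and>
        Cr r J (pdiff c j F))"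

definition smooth_on_CP :: "nat \<Rightarrow> ((nat \<Rightarrow> complex) set \<Rightarrow> real) \<Rightarrow> bool" where
  "smooth_on_CP m \<phi> \<longleftrightarrow> (\<forall>i\<le>m. \<forall>r. Cr r ({..m} - {i}) (\<lambda>w. \<phi> (chart_pt m i w)))"

definition dz :: "nat \<Rightarrow> ((nat \<Rightarrow> complex) \<Rightarrow> complex) \<Rightarrow> (nat \<Rightarrow> complex) \<Rightarrow> complex" where
  "dz j F w = (pdiff 1 j F w - \<i> * pdiff \<i> j F w) / 2"

definition dzbar :: "nat \<Rightarrow> ((nat \<Rightarrow> complex) \<Rightarrow> complex) \<Rightarrow> (nat \<Rightarrow> complex) \<Rightarrow> complex" where
  "dzbar j F w = (pdiff 1 j F w + \<i> * pdiff \<i> j F w) / 2"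

definition ddbar :: "nat \<Rightarrow> nat \<Rightarrow> ((nat \<Rightarrow> complex) \<Rightarrow> real) \<Rightarrow> (nat \<Rightarrow> complex) \<Rightarrow> complex" where
  "ddbar l n F = dz l (dzbar n (\<lambda>w. complex_of_real (F w)))"

section \<open>The metric and admissible functions\<close>

text \<open>Components of the metric in the chart \<open>{z\<^sub>i \<noteq> 0}\<close>.  For two charts the potentials
  \<open>(m+1) ln (\<Sum>\<^sub>j |z\<^sub>j|\<^sup>2 / |z\<^sub>i|\<^sup>2)\<close> differ by the pluriharmonic function
  \<open>(m+1) ln (|z\<^sub>h|\<^sup>2 / |z\<^sub>i|\<^sup>2)\<close>, so the formula given for \<open>i = 0\<close> yields
  the components of the same metric in every chart.\<close>

definition g_comp :: "nat \<Rightarrow> nat \<Rightarrow> nat \<Rightarrow> nat \<Rightarrow> (nat \<Rightarrow> complex) \<Rightarrow> complex" where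
  "g_comp m i l n w =
     of_nat (m + 1) * ddbar l n (\<lambda>v. ln (1 + (\<Sum>j\<in>{..m} - {i}. (cmod (v j))\<^sup>2))) w"

definition hermitian_pos_def :: "nat set \<Rightarrow> (nat \<Rightarrow> nat \<Rightarrow> complex) \<Rightarrow> bool" where
  "hermitian_pos_def J A \<longleftrightarrow>
     (\<forall>l\<in>J. \<forall>n\<in>J. A n l = cnj (A l n)) \<and>
     (\<forall>\<xi>::nat \<Rightarrow> complex. (\<exists>l\<in>J. \<xi> l \<noteq> 0) \<longrightarrow>
        Re (\<Sum>l\<in>J. \<Sum>n\<in>J. A l n * \<xi> l * cnj (\<xi> n)) > 0)"

definition g_admissible :: "nat \<Rightarrow> ((nat \<Rightarrow> complex) set \<Rightarrow> real) \<Rightarrow> bool" where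
  "g_admissible m \<phi> \<longleftrightarrow> smooth_on_CP m \<phi> \<and>
     (\<forall>i\<le>m. \<forall>w. hermitian_pos_def ({..m} - {i})
        (\<lambda>l n. g_comp m i l n w + ddbar l n (\<lambda>v. \<phi> (chart_pt m i v)) w))"

section \<open>The automorphism group\<close>

definition on_CP :: "nat \<Rightarrow> ((nat \<Rightarrow> complex) \<Rightarrow> (nat \<Rightarrow> complex)) \<Rightarrow> (nat \<Rightarrow> complex) set \<Rightarrow> (nat \<Rightarrow> complex) set" where
  "on_CP m f = (\<lambda>p\<in>CP m. f ` p)"

definition swap_coord :: "nat \<Rightarrow> nat \<Rightarrow> (nat \<Rightarrow> complex) \<Rightarrow> (nat \<Rightarrow> complex)" where
  "swap_coord i j z = z \<circ> Transposition.transpose i j"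

definition rot_coord :: "nat \<Rightarrow> real \<Rightarrow> (nat \<Rightarrow> complex) \<Rightarrow> (nat \<Rightarrow> complex)" where
  "rot_coord l \<theta> z = z(l := z l * exp (\<i> * of_real \<theta>))"

definition G_generators :: "nat \<Rightarrow> nat \<Rightarrow> ((nat \<Rightarrow> complex) set \<Rightarrow> (nat \<Rightarrow> complex) set) set" where
  "G_generators m k =
     {on_CP m (swap_coord i j) | i j. i \<in> {0..k} \<and> j \<in> {0..k}} \<union>
     {on_CP m (swap_coord p q) | p q. p \<in> {k+1..m} \<and> q \<in> {k+1..m}} \<union>
     {on_CP m (rot_coord l \<theta>) | l \<theta>. l \<in> {0..m} \<and> \<theta> \<in> {0..2*pi}}"

definition G_grp :: "nat \<Rightarrow> nat \<Rightarrow> ((nat \<Rightarrow> complex) set \<Rightarrow> (nat \<Rightarrow> complex) set) set" where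
  "G_grp m k = generate (BijGroup (CP m)) (G_generators m k)"

definition G_invariant :: "nat \<Rightarrow> nat \<Rightarrow> ((nat \<Rightarrow> complex) set \<Rightarrow> real) \<Rightarrow> bool" where
  "G_invariant m k \<phi> \<longleftrightarrow> (\<forall>\<gamma>\<in>G_grp m k. \<forall>p\<in>CP m. \<phi> (\<gamma> p) = \<phi> p)"

section \<open>The extremal function\<close>

definition ln_ext :: "real \<Rightarrow> ereal" where
  "ln_ext x = (if x = 0 then - \<infinity> else ereal (ln x))"

definition psi1_hom :: "nat \<Rightarrow> nat \<Rightarrow> (nat \<Rightarrow> complex) \<Rightarrow> ereal" where
  "psi1_hom m k z = ln_ext
     ((\<Prod>i\<in>{0..k}. cmod (z i)) powr (2 * (real m + 1) / (real k + 1)) /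
      (\<Sum>i\<in>{0..m}. (cmod (z i))\<^sup>2) ^ (m + 1))"

definition psi2_hom :: "nat \<Rightarrow> nat \<Rightarrow> (nat \<Rightarrow> complex) \<Rightarrow> ereal" where
  "psi2_hom m k z = ln_ext
     ((\<Prod>i\<in>{k+1..m}. cmod (z i)) powr (2 * (real m + 1) / (real m - real k)) /
      (\<Sum>i\<in>{0..m}. (cmod (z i))\<^sup>2) ^ (m + 1))"

text \<open>These functions of homogeneous coordinates are homogeneous of degree zero (see
  \<open>psi_hpoint\<close> below), so the image of a point under them is a singleton.\<close>

definition psi :: "nat \<Rightarrow> nat \<Rightarrow> (nat \<Rightarrow> complex) set \<Rightarrow> ereal" where
  "psi m k p = inf (the_elem (psi1_hom m k ` p)) (the_elem (psi2_hom m k ` p))"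

section \<open>Well-definedness\<close>

lemma scale_hvec: "z \<in> hvec m \<Longrightarrow> c \<noteq> 0 \<Longrightarrow> (\<lambda>i. c * z i) \<in> hvec m"
  by (auto simp: hvec_def)

lemma equiv_proj_rel: "equiv (hvec m) (proj_rel m)"
proof (rule equivI)
  show "proj_rel m \<subseteq> hvec m \<times> hvec m"
    by (auto simp: proj_rel_def)
  show "refl_on (hvec m) (proj_rel m)"
    by (auto simp: refl_on_def proj_rel_def intro: exI[of _ 1])
  show "sym (proj_rel m)"
  proof (rule symI)
    fix z w assume "(z, w) \<in> proj_rel m"
    then obtain c where c: "c \<noteq> 0" "w = (\<lambda>i. c * z i)" "z \<in> hvec m" "w \<in> hvec m"
      by (auto simp: proj_rel_def)
    have "z = (\<lambda>i. inverse c * w i)"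
      using c by (simp add: mult.assoc[symmetric])
    thus "(w, z) \<in> proj_rel m"
      using c by (auto simp: proj_rel_def intro!: exI[of _ "inverse c"])
  qed
  show "trans (proj_rel m)"
  proof (rule transI)
    fix x y z assume "(x, y) \<in> proj_rel m" "(y, z) \<in> proj_rel m"
    then obtain c d where "c \<noteq> 0" "y = (\<lambda>i. c * x i)" "d \<noteq> 0" "z = (\<lambda>i. d * y i)"
        "x \<in> hvec m" "z \<in> hvec m"
      by (auto simp: proj_rel_def)
    thus "(x, z) \<in> proj_rel m"
      by (auto simp: proj_rel_def mult.assoc intro!: exI[of _ "d * c"])
  qed
qed

lemma hpoint_eq: "z \<in> hvec m \<Longrightarrow> hpoint m z = {(\<lambda>i. c * z i) | c. c \<noteq> 0}"
  by (auto simp: hpoint_def proj_rel_def scale_hvec)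

lemma CP_eq: "CP m = hpoint m ` hvec m"
  by (auto simp: CP_def hpoint_def quotient_def)

lemma chart_pt_in_CP: "i \<le> m \<Longrightarrow> chart_pt m i w \<in> CP m"
  unfolding chart_pt_def CP_eq by (rule imageI) (auto simp: hvec_def)

lemma image_hpoint:
  assumes "z \<in> hvec m" "f z \<in> hvec m" "\<And>c. f (\<lambda>i. c * z i) = (\<lambda>i. c * f z i)"
  shows "f ` hpoint m z = hpoint m (f z)"
proof -
  have "f ` hpoint m z = {f (\<lambda>i. c * z i) | c. c \<noteq> 0}"
    using assms(1) by (auto simp: hpoint_eq)
  also have "\<dots> = hpoint m (f z)"
    using assms(2,3) by (simp add: hpoint_eq)
  finally show ?thesis .
qed

lemma on_CP_Bij:
  assumes f: "\<And>z. z \<in> hvec m \<Longrightarrow> f z \<in> hvec m" "\<And>c z. f (\<lambda>i. c * z i) = (\<lambda>i. c * f z i)"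
    and h: "\<And>z. z \<in> hvec m \<Longrightarrow> h z \<in> hvec m" "\<And>c z. h (\<lambda>i. c * z i) = (\<lambda>i. c * h z i)"
    and hf: "\<And>z. h (f z) = z" "\<And>z. f (h z) = z"
  shows "on_CP m f \<in> Bij (CP m)"
proof -
  have 1: "f ` p \<in> CP m" if "p \<in> CP m" for p
    using that f image_hpoint[of _ m f] by (auto simp: CP_eq)
  have 2: "h ` p \<in> CP m" if "p \<in> CP m" for p
    using that h image_hpoint[of _ m h] by (auto simp: CP_eq)
  have "bij_betw (\<lambda>p. f ` p) (CP m) (CP m)"
    by (rule bij_betw_byWitness[where f' = "\<lambda>p. h ` p"])
      (use 1 2 in \<open>auto simp: image_image hf\<close>)
  hence "bij_betw (on_CP m f) (CP m) (CP m)"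
    by (simp add: on_CP_def cong: bij_betw_cong)
  thus ?thesis by (simp add: Bij_def on_CP_def)
qed

lemma swap_coord_Bij:
  assumes "i \<le> m" "j \<le> m"
  shows "on_CP m (swap_coord i j) \<in> Bij (CP m)"
proof (rule on_CP_Bij[where h = "swap_coord i j"])
  fix z assume z: "z \<in> hvec m"
  then obtain l where l: "l \<le> m" "z l \<noteq> 0" by (auto simp: hvec_def)
  have "\<exists>a\<le>m. swap_coord i j z a \<noteq> 0"
    by (rule exI[of _ "Transposition.transpose i j l"])
      (use l assms in \<open>auto simp: swap_coord_def Transposition.transpose_def\<close>)
  thus "swap_coord i j z \<in> hvec m" "swap_coord i j z \<in> hvec m"
    using z assms by (auto simp: hvec_def swap_coord_def Transposition.transpose_def)
qed (auto simp: swap_coord_def fun_eq_iff)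

lemma rot_coord_Bij:
  assumes "l \<le> m"
  shows "on_CP m (rot_coord l \<theta>) \<in> Bij (CP m)"
proof -
  have *: "rot_coord l t z \<in> hvec m" if "z \<in> hvec m" for t z
    using that assms by (force simp: hvec_def rot_coord_def)
  show ?thesis
    by (rule on_CP_Bij[where h = "rot_coord l (- \<theta>)"])
      (simp_all add: *, auto simp: rot_coord_def fun_eq_iff mult.assoc exp_add[symmetric])
qed

lemma G_generators_subset: "k \<le> m \<Longrightarrow> G_generators m k \<subseteq> carrier (BijGroup (CP m))"
  by (auto simp: G_generators_def BijGroup_def intro!: swap_coord_Bij rot_coord_Bij)

lemma hom_quotient_scale:
  fixes z :: "nat \<Rightarrow> complex"
  assumes "finite A" "A \<noteq> {}" "c \<noteq> 0"
  shows "(\<Prod>i\<in>A. cmod (c * z i)) powr (2 * (real m + 1) / real (card A)) /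
           (\<Sum>i\<in>{0..m}. (cmod (c * z i))\<^sup>2) ^ (m + 1)
       = (\<Prod>i\<in>A. cmod (z i)) powr (2 * (real m + 1) / real (card A)) /
           (\<Sum>i\<in>{0..m}. (cmod (z i))\<^sup>2) ^ (m + 1)"
proof -
  have pos: "cmod c > 0" and card: "real (card A) > 0"
    using assms by (auto simp: card_gt_0_iff)
  have eq: "real (card A) * (2 * (real m + 1) / real (card A)) = real (2 * (m + 1))"
    using card by simp
  have "(cmod c ^ card A) powr (2 * (real m + 1) / real (card A))
      = cmod c powr (real (card A) * (2 * (real m + 1) / real (card A)))"
    using pos by (simp add: powr_realpow[symmetric] powr_powr)
  also have "\<dots> = cmod c ^ (2 * (m + 1))"
    unfolding eq using pos by (rule powr_realpow)
  finally have "(\<Prod>i\<in>A. cmod (c * z i)) powr (2 * (real m + 1) / real (card A))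
      = cmod c ^ (2 * (m + 1)) * (\<Prod>i\<in>A. cmod (z i)) powr (2 * (real m + 1) / real (card A))"
    by (simp add: norm_mult prod.distrib powr_mult prod_nonneg)
  moreover have "(\<Sum>i\<in>{0..m}. (cmod (c * z i))\<^sup>2) ^ (m + 1)
      = cmod c ^ (2 * (m + 1)) * (\<Sum>i\<in>{0..m}. (cmod (z i))\<^sup>2) ^ (m + 1)"
    by (simp only: norm_mult power_mult_distrib sum_distrib_left[symmetric] power_mult)
  ultimately show ?thesis
    using pos by simp
qed

lemma psi1_hom_scale: "c \<noteq> 0 \<Longrightarrow> psi1_hom m k (\<lambda>i. c * z i) = psi1_hom m k z"
  using hom_quotient_scale[of "{0..k}" c z m] by (simp add: psi1_hom_def add.commute)

lemma psi2_hom_scale: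
  assumes "c \<noteq> 0" "k < m"
  shows "psi2_hom m k (\<lambda>i. c * z i) = psi2_hom m k z"
proof -
  have "real (card {k+1..m}) = real m - real k" "{k+1..m} \<noteq> {}"
    using assms(2) by (auto simp: of_nat_diff)
  with hom_quotient_scale[of "{k+1..m}" c z m] assms(1) show ?thesis
    unfolding psi2_hom_def by simp
qed

lemma psi_hpoint:
  assumes "z \<in> hvec m" "k < m"
  shows "psi m k (hpoint m z) = inf (psi1_hom m k z) (psi2_hom m k z)"
proof -
  have "z \<in> hpoint m z"
    using assms(1) by (auto simp: hpoint_eq intro: exI[of _ 1])
  moreover have "psi1_hom m k y = psi1_hom m k z" "psi2_hom m k y = psi2_hom m k z"
    if "y \<in> hpoint m z" for y
    using that assms by (auto simp: hpoint_eq psi1_hom_scale psi2_hom_scale)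
  ultimately have "psi1_hom m k ` hpoint m z = {psi1_hom m k z}"
    "psi2_hom m k ` hpoint m z = {psi2_hom m k z}"
    by blast+
  thus ?thesis by (simp add: psi_def)
qed

end

theory Submission
  imports Defs
begin

text \<open>
  By torus invariance, \<open>\<phi>\<close> is determined by its values at points with non-negative real
  coordinates. Consider the potential \<open>\<Phi>(x) = (m+1) ln (\<Sum> x\<^sub>j\<^sup>2) + \<phi> [x]\<close> for such \<open>x\<close>. It
  satisfies \<open>\<Phi>(c x) = \<Phi>(x) + 2 (m+1) ln c\<close>, and in each affine chart it is, up to such a
  logarithmic term, a strictly plurisubharmonic function of the affine coordinates that depends
  on their absolute values only. This has two consequences.

  The function \<open>\<Phi>\<close> is nondecreasing in each coordinate (\<open>toric_psh_mono\<close>). In the chart of a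
  largest coordinate this gives \<open>\<phi> [x] \<le> \<Phi>(1,\<dots>,1)\<close> for all \<open>x\<close>, so that \<open>sup \<phi> = 0\<close> implies
  \<open>\<Phi>(1,\<dots>,1) \<ge> 0\<close> (\<open>admissible_le_hom_potential_one\<close>).

  The function \<open>\<Phi>\<close> is convex in the logarithms of the coordinates. As it is symmetric in
  \<open>x\<^sub>0, \<dots>, x\<^sub>k\<close> and in \<open>x\<^bsub>k+1\<^esub>, \<dots>, x\<^sub>m\<close>, it does not increase when the coordinates of either
  block are replaced by their geometric mean, \<open>a\<close> for the first and \<open>b\<close> for the second
  (\<open>hom_potential_geometric_mean\<close>).

  Hence, with \<open>c = min a b\<close> and by monotonicity,
  \<open>\<Phi>(x) \<ge> \<Phi>(a,\<dots>,a,b,\<dots>,b) \<ge> \<Phi>(c,\<dots>,c) = \<Phi>(1,\<dots>,1) + 2 (m+1) ln c \<ge> 2 (m+1) ln c\<close>,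
  and subtracting \<open>(m+1) ln (\<Sum> x\<^sub>j\<^sup>2)\<close> gives \<open>\<phi> \<ge> inf \<psi>\<^sub>1 \<psi>\<^sub>2\<close>.
\<close>

section \<open>Partial derivatives and the Levi form\<close>

lemma Cr_differentiable:
  assumes "Cr (Suc r) J F" "j \<in> J" "c \<in> {1, \<i>}"
  shows "(\<lambda>t::real. F (w(j := w j + of_real t * c))) differentiable at 0"
  using assms by auto

lemma Cr_pdiff: "Cr (Suc r) J F \<Longrightarrow> j \<in> J \<Longrightarrow> c \<in> {1, \<i>} \<Longrightarrow> Cr r J (pdiff c j F)"
  by auto

lemma Cr_continuous: "Cr r J F \<Longrightarrow> continuous_on UNIV F"
  by (cases r) auto

lemma Cr_subset: "Cr r J F \<Longrightarrow> K \<subseteq> J \<Longrightarrow> Cr r K F"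
  by (induction r arbitrary: F) auto

lemma has_vector_derivative_pdiff:
  assumes "\<And>w. (\<lambda>t::real. F (w(j := w j + of_real t * c))) differentiable at 0"
  shows "((\<lambda>t::real. F (w(j := z + of_real t * c))) has_vector_derivative
           pdiff c j F (w(j := z + of_real t0 * c))) (at t0)"
proof -
  let ?w = "w(j := z + of_real t0 * c)"
  have "((\<lambda>t::real. F (?w(j := ?w j + of_real t * c))) has_vector_derivative pdiff c j F ?w) (at (t0 - t0))"
    unfolding pdiff_def using assms[of ?w] by (simp add: vector_derivative_works)
  moreover have "((\<lambda>t. t - t0) has_vector_derivative 1) (at t0)"
    by (auto intro!: derivative_eq_intros)
  ultimately have "(((\<lambda>t::real. F (?w(j := ?w j + of_real t * c))) \<circ> (\<lambda>t. t - t0)) has_vector_derivative 1 *\<^sub>R pdiff c j F ?w) (at t0)"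
    by (intro vector_diff_chain_at) auto
  thus ?thesis by (simp add: o_def algebra_simps)
qed

lemma has_real_derivative_pdiff_1:
  fixes F :: "(nat \<Rightarrow> complex) \<Rightarrow> real"
  assumes "Cr (Suc r) J F" "j \<in> J"
  shows "((\<lambda>t. F (w(j := of_real t))) has_real_derivative pdiff 1 j F (w(j := of_real t0))) (at t0)"
  using has_vector_derivative_pdiff[of F j 1 w 0 t0] Cr_differentiable[OF assms, of 1]
  by (simp add: has_real_derivative_iff_has_vector_derivative)

lemma pdiff_eqI:
  assumes "((\<lambda>t::real. F (w(j := w j + of_real t * c))) has_vector_derivative D) (at 0)"
  shows "pdiff c j F w = D"
  unfolding pdiff_def using assms by (rule vector_derivative_at)

lemma pdiff_linear:
  fixes F G :: "(nat \<Rightarrow> complex) \<Rightarrow> real"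
  assumes "(\<lambda>t::real. F (w(j := w j + of_real t * c))) differentiable at 0"
    and "(\<lambda>t::real. G (w(j := w j + of_real t * c))) differentiable at 0"
  shows "pdiff c j (\<lambda>w. a * F w + G w) w = a * pdiff c j F w + pdiff c j G w"
  using assms unfolding vector_derivative_works
  by (intro pdiff_eqI has_vector_derivative_add has_vector_derivative_mult_right)
     (simp_all add: pdiff_def)

lemma Cr_linear:
  fixes F G :: "(nat \<Rightarrow> complex) \<Rightarrow> real"
  assumes "Cr r J F" "Cr r J G"
  shows "Cr r J (\<lambda>w. a * F w + G w)"
  using assms
proof (induction r arbitrary: F G)
  case 0
  thus ?case by (auto intro!: continuous_intros)
next
  case (Suc r)
  have "pdiff c j (\<lambda>w. a * F w + G w) = (\<lambda>w. a * pdiff c j F w + pdiff c j G w)"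
    if "j \<in> J" "c \<in> {1, \<i>}" for j c
    using Suc.prems that by (intro ext pdiff_linear) auto
  thus ?case
    using Suc by (auto intro!: continuous_intros derivative_intros)
qed

text \<open>Chain rule along a curve of real points that moves only the coordinates in \<open>J\<close>. As
  \<open>nat \<Rightarrow> complex\<close> is not a normed space, the coordinates are added one at a time: in each step the function
  depends on two real variables, the curve parameter and the value of the new coordinate, and the
  partial derivative in the latter is jointly continuous.\<close>

lemma chain_rule_pdiff:
  fixes F :: "(nat \<Rightarrow> complex) \<Rightarrow> real" and \<gamma> \<gamma>' :: "real \<Rightarrow> nat \<Rightarrow> real" and b :: "nat \<Rightarrow> real"
  assumes "finite J" "Cr (Suc 0) J F"
    and "\<And>j t. j \<in> J \<Longrightarrow> ((\<lambda>t. \<gamma> t j) has_real_derivative \<gamma>' t j) (at t)"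
    and "\<And>j t. j \<notin> J \<Longrightarrow> \<gamma> t j = b j"
  shows "((\<lambda>t. F (\<lambda>j. of_real (\<gamma> t j))) has_real_derivative
           (\<Sum>j\<in>J. pdiff 1 j F (\<lambda>j. of_real (\<gamma> t j)) * \<gamma>' t j)) (at t)"
  using assms
proof (induction J arbitrary: \<gamma> b t rule: finite_induct)
  case empty
  hence "\<gamma> t = b" for t by auto
  thus ?case by simp
next
  case (insert a J)
  define H where "H = (\<lambda>s u. F ((\<lambda>j. of_real (\<gamma> s j))(a := of_real u)))"
  have cont_\<gamma>: "continuous_on UNIV (\<lambda>s. \<gamma> s j)" for j
  proof (cases "j \<in> insert a J")
    case True
    with insert.prems(2) show ?thesis
      by (meson DERIV_isCont continuous_at_imp_continuous_on)
  next
    case False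
    thus ?thesis using insert.prems(3) by simp
  qed
  have upd: "(\<lambda>j. complex_of_real (\<gamma> s j))(a := of_real u) = (\<lambda>j. of_real (((\<gamma> s)(a := u)) j))" for s u
    by auto
  have fx: "((\<lambda>s. H s u) has_real_derivative
      (\<Sum>j\<in>J. pdiff 1 j F ((\<lambda>j. of_real (\<gamma> s j))(a := of_real u)) * \<gamma>' s j)) (at s)" for s u
    unfolding H_def upd
  proof (rule insert.IH[where b = "b(a := u)"])
    show "Cr (Suc 0) J F" using insert.prems(1) by auto
    show "((\<lambda>s. ((\<gamma> s)(a := u)) j) has_real_derivative \<gamma>' s j) (at s)" if "j \<in> J" for j s
      using that insert.hyps insert.prems(2)[of j s] by (cases "j = a") auto
    show "((\<gamma> s)(a := u)) j = (b(a := u)) j" if "j \<notin> J" for j s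
      using that insert.prems(3)[of j s] by auto
  qed
  have fy: "((\<lambda>u. H s u) has_real_derivative
      pdiff 1 a F ((\<lambda>j. of_real (\<gamma> s j))(a := of_real u))) (at u)" for s u
    unfolding H_def
    by (rule has_real_derivative_pdiff_1[OF insert.prems(1)]) simp
  have c1: "continuous_on UNIV (\<lambda>p::real\<times>real. (\<lambda>j. complex_of_real (\<gamma> (fst p) j))(a := of_real (snd p)))"
  proof (rule continuous_on_coordinatewise_then_product)
    fix i
    have "continuous_on UNIV (\<lambda>p::real\<times>real. \<gamma> (fst p) i)"
      using cont_\<gamma>[of i] by (rule continuous_on_compose2) (auto intro!: continuous_intros)
    thus "continuous_on UNIV (\<lambda>p::real\<times>real. ((\<lambda>j. complex_of_real (\<gamma> (fst p) j))(a := of_real (snd p))) i)"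
      by (cases "i = a") (auto intro!: continuous_intros)
  qed
  have c2: "continuous_on UNIV (pdiff 1 a F)"
    using insert.prems(1) by auto
  have "continuous_on UNIV (\<lambda>p. pdiff 1 a F ((\<lambda>j. of_real (\<gamma> (fst p) j))(a := of_real (snd p))))"
    using continuous_on_compose2[OF c2 c1] by simp
  hence "continuous (at (t, \<gamma> t a)) (\<lambda>p. blinfun_mult_right (pdiff 1 a F ((\<lambda>j. of_real (\<gamma> (fst p) j))(a := of_real (snd p)))))"
    by (intro continuous_intros) (simp add: continuous_on_eq_continuous_at)
  hence "((\<lambda>(s, u). H s u) has_derivative
     (\<lambda>(ts, tu). (\<Sum>j\<in>J. pdiff 1 j F ((\<lambda>j. of_real (\<gamma> t j))(a := of_real (\<gamma> t a))) * \<gamma>' t j) * ts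
       + blinfun_mult_right (pdiff 1 a F ((\<lambda>j. of_real (\<gamma> t j))(a := of_real (\<gamma> t a)))) tu))
     (at (t, \<gamma> t a) within UNIV \<times> UNIV)"
    using fx[of "\<gamma> t a" t] fy
    by (intro has_derivative_partialsI[where fy = "\<lambda>s u. blinfun_mult_right (pdiff 1 a F ((\<lambda>j. of_real (\<gamma> s j))(a := of_real u)))"])
       (auto simp: has_field_derivative_def case_prod_beta')
  hence H: "((\<lambda>(s, u). H s u) has_derivative
     (\<lambda>(ts, tu). (\<Sum>j\<in>J. pdiff 1 j F ((\<lambda>j. of_real (\<gamma> t j))(a := of_real (\<gamma> t a))) * \<gamma>' t j) * ts
       + blinfun_mult_right (pdiff 1 a F ((\<lambda>j. of_real (\<gamma> t j))(a := of_real (\<gamma> t a)))) tu))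
     (at (t, \<gamma> t a))" by simp
  have "((\<lambda>t. \<gamma> t a) has_derivative (\<lambda>h. \<gamma>' t a * h)) (at t)"
    using insert.prems(2)[of a t] by (simp add: has_field_derivative_def)
  hence \<gamma>a: "((\<lambda>t. (t, \<gamma> t a)) has_derivative (\<lambda>h. (h, \<gamma>' t a * h))) (at t)"
    by (intro has_derivative_Pair has_derivative_ident)
  have "(\<lambda>j. complex_of_real (\<gamma> s j))(a := of_real (\<gamma> s a)) = (\<lambda>j. of_real (\<gamma> s j))" for s
    by auto
  with has_derivative_compose[OF \<gamma>a H] show ?case
    using insert.hyps
    by (auto simp: H_def has_field_derivative_def algebra_simps fun_eq_iff elim!: has_derivative_eq_rhs)
qed

text \<open>The shape of the function is that of \<open>dzbar\<close> applied to a real function.\<close>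

lemma pdiff_of_real_complex:
  fixes P Q :: "(nat \<Rightarrow> complex) \<Rightarrow> real"
  assumes "(\<lambda>t::real. P (w(j := w j + of_real t * c))) differentiable at 0"
    and "(\<lambda>t::real. Q (w(j := w j + of_real t * c))) differentiable at 0"
  shows "pdiff c j (\<lambda>w. (of_real (P w) + \<i> * of_real (Q w)) / 2) w
       = (of_real (pdiff c j P w) + \<i> * of_real (pdiff c j Q w)) / (2::complex)"
proof (rule pdiff_eqI)
  have "((\<lambda>t. P (w(j := w j + of_real t * c))) has_vector_derivative pdiff c j P w) (at 0)"
    "((\<lambda>t. Q (w(j := w j + of_real t * c))) has_vector_derivative pdiff c j Q w) (at 0)"
    using assms by (simp_all add: vector_derivative_works pdiff_def)
  thus "((\<lambda>t. (of_real (P (w(j := w j + of_real t * c))) + \<i> * of_real (Q (w(j := w j + of_real t * c)))) / 2)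
     has_vector_derivative (of_real (pdiff c j P w) + \<i> * of_real (pdiff c j Q w)) / (2::complex)) (at 0)"
    by (intro has_vector_derivative_divide has_vector_derivative_add has_vector_derivative_mult_right
        has_vector_derivative_of_real) (simp_all add: has_real_derivative_iff_has_vector_derivative)
qed

text \<open>With \<open>4 \<partial>\<^sub>l \<partial>\<^sub>n\<close>-bar \<open>= (\<partial>/\<partial>x\<^sub>l - \<i> \<partial>/\<partial>y\<^sub>l) (\<partial>/\<partial>x\<^sub>n + \<i> \<partial>/\<partial>y\<^sub>n)\<close>, the mixed
  \<open>x\<close>-\<open>y\<close> derivatives only contribute to the imaginary part.\<close>

lemma Re_ddbar:
  assumes "Cr 2 J F" "l \<in> J" "n \<in> J"
  shows "Re (ddbar l n F w) = (pdiff 1 l (pdiff 1 n F) w + pdiff \<i> l (pdiff \<i> n F) w) / 4"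
proof -
  have C: "Cr (Suc (Suc 0)) J F" using assms(1) by (simp add: numeral_2_eq_2)
  have one: "pdiff c n (\<lambda>w. complex_of_real (F w)) w = of_real (pdiff c n F w)"
    if "c \<in> {1, \<i>}" for c w
  proof (rule pdiff_eqI)
    show "((\<lambda>t. complex_of_real (F (w(n := w n + of_real t * c)))) has_vector_derivative
        of_real (pdiff c n F w)) (at 0)"
      using has_vector_derivative_pdiff[of F n c w "w n" 0] Cr_differentiable[OF C assms(3) that]
      by (intro has_vector_derivative_of_real) (simp add: has_real_derivative_iff_has_vector_derivative)
  qed
  have dzbar: "dzbar n (\<lambda>w. complex_of_real (F w)) = (\<lambda>w. (of_real (pdiff 1 n F w) + \<i> * of_real (pdiff \<i> n F w)) / 2)"
    by (simp add: dzbar_def one fun_eq_iff)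
  have two: "pdiff c l (\<lambda>w. (of_real (pdiff 1 n F w) + \<i> * of_real (pdiff \<i> n F w)) / (2::complex)) w =
     (of_real (pdiff c l (pdiff 1 n F) w) + \<i> * of_real (pdiff c l (pdiff \<i> n F) w)) / 2"
    if "c \<in> {1, \<i>}" for c
    using Cr_differentiable[OF Cr_pdiff[OF C assms(3)] assms(2) that]
    by (intro pdiff_of_real_complex) auto
  show ?thesis
    unfolding ddbar_def dzbar dz_def by (simp add: two)
qed

text \<open>Four times the Levi form of \<open>F\<close> at \<open>w\<close>, restricted to real vectors \<open>\<xi>\<close>. By the formula for
  \<open>Re (ddbar l n F w)\<close> above, only the derivatives of type \<open>xx\<close> and \<open>yy\<close> enter.\<close>

definition levi :: "nat set \<Rightarrow> ((nat \<Rightarrow> complex) \<Rightarrow> real) \<Rightarrow> (nat \<Rightarrow> complex) \<Rightarrow> (nat \<Rightarrow> real) \<Rightarrow> real" where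
  "levi J F w \<xi> = (\<Sum>l\<in>J. \<Sum>n\<in>J.
     (pdiff 1 l (pdiff 1 n F) w + pdiff \<i> l (pdiff \<i> n F) w) * \<xi> l * \<xi> n)"

lemma levi_subset:
  assumes "finite J" "K \<subseteq> J" "\<And>j. j \<notin> K \<Longrightarrow> \<xi> j = 0"
  shows "levi K F w \<xi> = levi J F w \<xi>"
proof -
  have "levi J F w \<xi> = (\<Sum>l\<in>K. \<Sum>n\<in>J.
     (pdiff 1 l (pdiff 1 n F) w + pdiff \<i> l (pdiff \<i> n F) w) * \<xi> l * \<xi> n)"
    unfolding levi_def by (rule sum.mono_neutral_right) (use assms in auto)
  also have "\<dots> = levi K F w \<xi>"
    unfolding levi_def by (intro sum.cong refl sum.mono_neutral_right) (use assms in auto)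
  finally show ?thesis ..
qed

lemma levi_nonneg_subset:
  assumes "finite J" "K \<subseteq> J" "\<And>w \<xi>. levi J F w \<xi> \<ge> 0"
  shows "levi K F w \<xi> \<ge> 0"
proof -
  have "levi K F w \<xi> = levi K F w (\<lambda>j. if j \<in> K then \<xi> j else 0)"
    unfolding levi_def by (intro sum.cong) auto
  also have "\<dots> = levi J F w (\<lambda>j. if j \<in> K then \<xi> j else 0)"
    by (rule levi_subset) (use assms in auto)
  finally show ?thesis using assms(3) by simp
qed

section \<open>Torus-invariant functions at real points\<close>

text \<open>Invariance under rotation of each of the coordinates in \<open>J\<close>, expressed as dependence on their
  absolute values only.\<close>

definition toric :: "nat set \<Rightarrow> ((nat \<Rightarrow> complex) \<Rightarrow> 'a) \<Rightarrow> bool" where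
  "toric J F \<longleftrightarrow> (\<forall>j\<in>J. \<forall>w. F (w(j := of_real (cmod (w j)))) = F w)"

lemma toric_cong:
  assumes "toric J F" "j \<in> J" "cmod a = cmod b"
  shows "F (w(j := a)) = F (w(j := b))"
proof -
  have "F (w(j := a)) = F ((w(j := a))(j := of_real (cmod ((w(j := a)) j))))"
    using assms unfolding toric_def by metis
  also have "\<dots> = F ((w(j := b))(j := of_real (cmod ((w(j := b)) j))))"
    using assms by simp
  also have "\<dots> = F (w(j := b))"
    using assms unfolding toric_def by metis
  finally show ?thesis .
qed

text \<open>In the imaginary direction, a rotation-invariant function is even around a real point.\<close>

lemma pdiff_imag_toric_real:
  fixes F :: "(nat \<Rightarrow> complex) \<Rightarrow> real"
  assumes "Cr (Suc r) J F" "toric J F" "j \<in> J" "Im (w j) = 0"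
  shows "pdiff \<i> j F w = 0"
proof -
  define q where "q = (\<lambda>t::real. F (w(j := w j + of_real t * \<i>)))"
  have "cmod (w j + of_real (- t) * \<i>) = cmod (w j + of_real t * \<i>)" for t
    using assms(4) by (simp add: cmod_def)
  hence even: "(\<lambda>t. q (- t)) = q"
    unfolding q_def using toric_cong[OF assms(2,3)] by (intro ext) blast
  have D: "(q has_real_derivative pdiff \<i> j F w) (at 0)"
    using has_vector_derivative_pdiff[of F j \<i> w "w j" 0] Cr_differentiable[OF assms(1,3), of \<i>]
    by (simp add: q_def has_real_derivative_iff_has_vector_derivative)
  hence "((\<lambda>t. q (- t)) has_real_derivative pdiff \<i> j F w * (- 1)) (at 0)"
    by (intro DERIV_chain2[where f = q]) (auto intro!: derivative_eq_intros)
  with D even have "pdiff \<i> j F w = pdiff \<i> j F w * (- 1)"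
    using DERIV_unique by metis
  thus ?thesis by simp
qed

lemma pdiff_imag_pdiff_imag_toric_neq:
  fixes F :: "(nat \<Rightarrow> complex) \<Rightarrow> real"
  assumes "Cr (Suc r) J F" "toric J F" "n \<in> J" "l \<noteq> n" "Im (w n) = 0"
  shows "pdiff \<i> l (pdiff \<i> n F) w = 0"
proof (rule pdiff_eqI)
  have "pdiff \<i> n F (w(l := w l + of_real t * \<i>)) = 0" for t
    by (rule pdiff_imag_toric_real[OF assms(1-3)]) (use assms in auto)
  thus "((\<lambda>t. pdiff \<i> n F (w(l := w l + of_real t * \<i>))) has_vector_derivative 0) (at 0)"
    by simp
qed

text \<open>With \<open>h(r)\<close> the restriction to positive \<open>w l = r\<close>, the function is \<open>h (sqrt (r\<^sup>2 + t\<^sup>2))\<close> at \<open>r + \<i> t\<close>,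
  whose second derivative at \<open>t = 0\<close> is \<open>h' (r) / r\<close>. Together with the \<open>xx\<close> derivative
  this is the polar form \<open>h'' + h' / r\<close> of the Laplacian.\<close>

lemma pdiff_imag_pdiff_imag_toric_eq:
  fixes F :: "(nat \<Rightarrow> complex) \<Rightarrow> real"
  assumes "Cr 2 J F" "toric J F" "l \<in> J" "w l = of_real r" "r > 0"
  shows "pdiff \<i> l (pdiff \<i> l F) w = pdiff 1 l F w / r"
proof (rule pdiff_eqI)
  have C: "Cr (Suc (Suc 0)) J F" using assms(1) by (simp add: numeral_2_eq_2)
  define p where "p = (\<lambda>s. pdiff 1 l F (w(l := of_real s)))"
  define \<rho> where "\<rho> = (\<lambda>t. sqrt (r\<^sup>2 + t\<^sup>2))"
  have \<rho>_pos: "\<rho> t > 0" for t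
    using assms(5) by (simp add: \<rho>_def add_pos_nonneg)
  have F\<rho>: "F (w(l := w l + of_real t * \<i>)) = F (w(l := of_real (\<rho> t)))" for t
    by (rule toric_cong[OF assms(2,3)]) (simp add: assms(4) cmod_def \<rho>_def)
  have k: "pdiff \<i> l F (w(l := w l + of_real t * \<i>)) = p (\<rho> t) * (t / \<rho> t)" for t
  proof -
    have "(\<rho> has_real_derivative t / \<rho> t) (at t)"
      using \<rho>_pos[of t] unfolding \<rho>_def
      by (auto intro!: derivative_eq_intros simp: field_simps)
    moreover have "((\<lambda>s. F (w(l := of_real s))) has_real_derivative p (\<rho> t)) (at (\<rho> t))"
      unfolding p_def by (rule has_real_derivative_pdiff_1[OF C assms(3)])
    ultimately have "((\<lambda>t. F (w(l := of_real (\<rho> t)))) has_real_derivative p (\<rho> t) * (t / \<rho> t)) (at t)"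
      by (rule DERIV_chain2[rotated])
    hence "((\<lambda>t. F (w(l := w l + of_real t * \<i>))) has_real_derivative p (\<rho> t) * (t / \<rho> t)) (at t)"
      by (simp add: F\<rho>)
    moreover have "((\<lambda>t. F (w(l := w l + of_real t * \<i>))) has_real_derivative
        pdiff \<i> l F (w(l := w l + of_real t * \<i>))) (at t)"
      using has_vector_derivative_pdiff[of F l \<i> w "w l" t] Cr_differentiable[OF C assms(3), of \<i>]
      by (simp add: has_real_derivative_iff_has_vector_derivative)
    ultimately show ?thesis using DERIV_unique by blast
  qed
  have "continuous_on UNIV (\<lambda>s. pdiff 1 l F (w(l := of_real s)))"
  proof (rule continuous_on_compose2[of UNIV "pdiff 1 l F"])
    show "continuous_on UNIV (pdiff 1 l F)"
      using Cr_continuous[OF Cr_pdiff[OF C assms(3), of 1]] by simp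
    show "continuous_on UNIV (\<lambda>s. w(l := complex_of_real s))"
    proof (rule continuous_on_coordinatewise_then_product)
      show "continuous_on UNIV (\<lambda>s. (w(l := complex_of_real s)) i)" for i
        by (cases "i = l") (auto intro!: continuous_intros)
    qed
  qed auto
  hence "isCont p (\<rho> 0)"
    by (simp add: p_def continuous_on_eq_continuous_at)
  moreover have "isCont \<rho> 0"
    unfolding \<rho>_def by (intro continuous_intros)
  ultimately have "isCont (\<lambda>t. p (\<rho> t) / \<rho> t) 0"
    using \<rho>_pos[of 0] by (intro continuous_intros isCont_o2[of _ \<rho> p]) auto
  moreover have "\<rho> 0 = r" "p r = pdiff 1 l F w"
    using assms(5) by (simp_all add: \<rho>_def p_def flip: assms(4))
  ultimately have "((\<lambda>t. p (\<rho> t) * (t / \<rho> t)) has_real_derivative pdiff 1 l F w / r) (at 0)"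
    unfolding CARAT_DERIV by (intro exI[of _ "\<lambda>t. p (\<rho> t) / \<rho> t"]) auto
  thus "((\<lambda>t. pdiff \<i> l F (w(l := w l + of_real t * \<i>))) has_vector_derivative pdiff 1 l F w / r) (at 0)"
    unfolding k by (simp add: has_real_derivative_iff_has_vector_derivative)
qed

section \<open>Monotonicity and logarithmic convexity of torus-invariant plurisubharmonic functions\<close>

text \<open>As a function of the radius \<open>r = |w l|\<close>, \<open>F\<close> satisfies \<open>(r h')' = r (h'' + h' / r) \<ge> 0\<close>; since
  \<open>r h'\<close> vanishes at \<open>0\<close>, \<open>h' \<ge> 0\<close>.\<close>

lemma toric_psh_mono_coord:
  fixes F :: "(nat \<Rightarrow> complex) \<Rightarrow> real"
  assumes "finite J" "Cr 2 J F" "toric J F" "\<And>w \<xi>. levi J F w \<xi> \<ge> 0"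
    and "l \<in> J" "0 \<le> s" "s \<le> t"
  shows "F (w(l := of_real s)) \<le> F (w(l := of_real t))"
proof -
  have C: "Cr (Suc (Suc 0)) J F" using assms(2) by (simp add: numeral_2_eq_2)
  define h where "h = (\<lambda>r. F (w(l := of_real r)))"
  define p where "p = (\<lambda>r. pdiff 1 l F (w(l := of_real r)))"
  define p' where "p' = (\<lambda>r. pdiff 1 l (pdiff 1 l F) (w(l := of_real r)))"
  have h: "(h has_real_derivative p r) (at r)" for r
    unfolding h_def p_def by (rule has_real_derivative_pdiff_1[OF C assms(5)])
  have p: "(p has_real_derivative p' r) (at r)" for r
    unfolding p_def p'_def
    by (rule has_real_derivative_pdiff_1[OF Cr_pdiff[OF C assms(5)] assms(5)]) simp
  have lap: "p' r + p r / r \<ge> 0" if "r > 0" for r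
  proof -
    have "levi {l} F (w(l := of_real r)) (\<lambda>_. 1) \<ge> 0"
      by (rule levi_nonneg_subset[OF assms(1) _ assms(4)]) (use assms(5) in auto)
    moreover have "pdiff \<i> l (pdiff \<i> l F) (w(l := of_real r)) = p r / r"
      unfolding p_def
      by (rule pdiff_imag_pdiff_imag_toric_eq[OF assms(2,3,5) _ that]) simp
    ultimately show ?thesis by (simp add: levi_def p'_def)
  qed
  have rp: "((\<lambda>r. r * p r) has_real_derivative p r + r * p' r) (at r)" for r
    using p[of r] by (auto intro!: derivative_eq_intros)
  have p_nonneg: "p r \<ge> 0" if "r > 0" for r
  proof -
    have "0 * p 0 \<le> r * p r"
    proof (rule DERIV_nonneg_imp_increasing_open[of 0 r "\<lambda>r. r * p r"])
      show "\<exists>y. ((\<lambda>r. r * p r) has_real_derivative y) (at x) \<and> 0 \<le> y" if "0 < x" for x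
      proof -
        have "x * (p' x + p x / x) \<ge> 0" using lap[OF that] that by simp
        hence "p x + x * p' x \<ge> 0" using that by (simp add: algebra_simps)
        with rp show ?thesis by blast
      qed
      show "continuous_on {0..r} (\<lambda>r. r * p r)"
        using rp by (meson DERIV_isCont continuous_at_imp_continuous_on)
    qed (use that in auto)
    thus ?thesis using that by (simp add: zero_le_mult_iff)
  qed
  have "h s \<le> h t"
  proof (rule DERIV_nonneg_imp_increasing_open[of s t h])
    show "\<exists>y. (h has_real_derivative y) (at x) \<and> 0 \<le> y" if "s < x" for x
      using h[of x] p_nonneg[of x] that assms(6) by fastforce
    show "continuous_on {s..t} h"
      using h by (meson DERIV_isCont continuous_at_imp_continuous_on)
  qed (rule assms(7))
  thus ?thesis by (simp add: h_def)
qed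

lemma toric_psh_mono:
  fixes F :: "(nat \<Rightarrow> complex) \<Rightarrow> real"
  assumes "finite J" "Cr 2 J F" "toric J F" "\<And>w \<xi>. levi J F w \<xi> \<ge> 0"
    and "\<And>j. j \<in> J \<Longrightarrow> 0 \<le> x j \<and> x j \<le> y j" "\<And>j. j \<notin> J \<Longrightarrow> x j = y j"
  shows "F (\<lambda>j. of_real (x j)) \<le> F (\<lambda>j. of_real (y j))"
proof -
  have "F (\<lambda>j. of_real (x j)) \<le> F (\<lambda>j. of_real (if j \<in> K then y j else x j))" if "K \<subseteq> J" for K
    using finite_subset[OF that assms(1)] that
  proof (induction K rule: finite_induct)
    case (insert l K)
    let ?w = "\<lambda>j. complex_of_real (if j \<in> K then y j else x j)"
    have "F (\<lambda>j. of_real (x j)) \<le> F (?w(l := of_real (x l)))"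
      using insert by (simp add: fun_upd_idem)
    also have "\<dots> \<le> F (?w(l := of_real (y l)))"
      using insert.prems assms(5)[of l] by (intro toric_psh_mono_coord[OF assms(1-4)]) auto
    also have "?w(l := of_real (y l)) = (\<lambda>j. of_real (if j \<in> insert l K then y j else x j))"
      by auto
    finally show ?case .
  qed simp
  from this[of J] show ?thesis using assms(6) by (simp cong: if_cong)
qed

text \<open>Along \<open>t \<mapsto> (r\<^sub>j exp (t d\<^sub>j))\<^sub>j\<close> the second derivative of \<open>F\<close> is \<open>levi\<close> in the direction
  \<open>(r\<^sub>j d\<^sub>j exp (t d\<^sub>j))\<^sub>j\<close>. So \<open>F\<close> is convex in the logarithms of the radii, and lies above its
  tangent at \<open>t = 0\<close>, which is horizontal by the last assumption.\<close>

lemma toric_psh_log_convex: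
  fixes F :: "(nat \<Rightarrow> complex) \<Rightarrow> real" and r d :: "nat \<Rightarrow> real"
  assumes "finite J" "Cr 2 J F" "toric J F" "\<And>w \<xi>. levi J F w \<xi> \<ge> 0"
    and "\<And>j. j \<in> J \<Longrightarrow> r j > 0" "\<And>j. j \<notin> J \<Longrightarrow> d j = 0"
    and "(\<Sum>j\<in>J. pdiff 1 j F (\<lambda>j. of_real (r j)) * (r j * d j)) = 0"
  shows "F (\<lambda>j. of_real (r j)) \<le> F (\<lambda>j. of_real (r j * exp (d j)))"
proof -
  have C: "Cr (Suc (Suc 0)) J F" using assms(2) by (simp add: numeral_2_eq_2)
  hence C1: "Cr (Suc 0) J F" by auto
  define \<gamma> where "\<gamma> = (\<lambda>t j. r j * exp (t * d j))"
  define W where "W = (\<lambda>t j. complex_of_real (\<gamma> t j))"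
  have \<gamma>: "((\<lambda>t. \<gamma> t j) has_real_derivative \<gamma> t j * d j) (at t)" for j t
    unfolding \<gamma>_def by (auto intro!: derivative_eq_intros)
  have \<gamma>_pos: "\<gamma> t j > 0" if "j \<in> J" for t j
    using assms(5)[OF that] by (simp add: \<gamma>_def)
  have \<gamma>_const: "\<gamma> t j = r j" if "j \<notin> J" for t j
    using assms(6)[OF that] by (simp add: \<gamma>_def)
  define g' where "g' = (\<lambda>t. \<Sum>j\<in>J. pdiff 1 j F (W t) * (\<gamma> t j * d j))"
  have g: "((\<lambda>t. F (W t)) has_real_derivative g' t) (at t)" for t
    unfolding g'_def W_def
    by (rule chain_rule_pdiff[OF assms(1) C1 \<gamma> \<gamma>_const])
  have pd: "((\<lambda>t. pdiff 1 j F (W t)) has_real_derivative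
      (\<Sum>l\<in>J. pdiff 1 l (pdiff 1 j F) (W t) * (\<gamma> t l * d l))) (at t)" if "j \<in> J" for t j
    unfolding W_def
    by (rule chain_rule_pdiff[OF assms(1) Cr_pdiff[OF C that] \<gamma> \<gamma>_const]) simp
  have g': "(g' has_real_derivative levi J F (W t) (\<lambda>j. \<gamma> t j * d j)) (at t)" for t
  proof -
    \<comment> \<open>At real points the \<open>yy\<close> part of the Levi matrix is diagonal and gives the first-order term
      in the second derivative of \<open>F\<close> along the curve.\<close>
    have diag: "(\<Sum>l\<in>J. pdiff \<i> l (pdiff \<i> n F) (W t) * (\<gamma> t l * d l) * (\<gamma> t n * d n))
        = pdiff 1 n F (W t) * (\<gamma> t n * d n * d n)" if "n \<in> J" for n
    proof -
      have "(\<Sum>l\<in>J. pdiff \<i> l (pdiff \<i> n F) (W t) * (\<gamma> t l * d l) * (\<gamma> t n * d n))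
        = (\<Sum>l\<in>J. if l = n then pdiff \<i> l (pdiff \<i> n F) (W t) * (\<gamma> t l * d l) * (\<gamma> t n * d n) else 0)"
      proof (intro sum.cong refl)
        fix l
        show "pdiff \<i> l (pdiff \<i> n F) (W t) * (\<gamma> t l * d l) * (\<gamma> t n * d n) =
          (if l = n then pdiff \<i> l (pdiff \<i> n F) (W t) * (\<gamma> t l * d l) * (\<gamma> t n * d n) else 0)"
          using pdiff_imag_pdiff_imag_toric_neq[OF C1 assms(3) that, of l "W t"] by (auto simp: W_def)
      qed
      also have "\<dots> = pdiff \<i> n (pdiff \<i> n F) (W t) * (\<gamma> t n * d n) * (\<gamma> t n * d n)"
        using that assms(1) by simp
      also have "pdiff \<i> n (pdiff \<i> n F) (W t) = pdiff 1 n F (W t) / \<gamma> t n"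
        by (rule pdiff_imag_pdiff_imag_toric_eq[OF assms(2,3) that _ \<gamma>_pos[OF that]]) (simp add: W_def)
      also have "\<dots> * (\<gamma> t n * d n) * (\<gamma> t n * d n) = pdiff 1 n F (W t) * (\<gamma> t n * d n * d n)"
        using \<gamma>_pos[OF that, of t] by simp
      finally show ?thesis .
    qed
    have "levi J F (W t) (\<lambda>j. \<gamma> t j * d j) = (\<Sum>n\<in>J. \<Sum>l\<in>J.
     (pdiff 1 l (pdiff 1 n F) (W t) + pdiff \<i> l (pdiff \<i> n F) (W t)) * (\<gamma> t l * d l) * (\<gamma> t n * d n))"
      unfolding levi_def by (rule sum.swap)
    also have "\<dots> = (\<Sum>n\<in>J. (\<Sum>l\<in>J. pdiff 1 l (pdiff 1 n F) (W t) * (\<gamma> t l * d l)) * (\<gamma> t n * d n)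
        + pdiff 1 n F (W t) * (\<gamma> t n * d n * d n))"
      by (intro sum.cong refl)
        (simp add: ring_distribs sum.distrib diag sum_distrib_right)
    finally have eq: "levi J F (W t) (\<lambda>j. \<gamma> t j * d j) = \<dots>" .
    show ?thesis
      unfolding g'_def eq
    proof (rule DERIV_sum)
      fix n assume n: "n \<in> J"
      show "((\<lambda>t. pdiff 1 n F (W t) * (\<gamma> t n * d n)) has_real_derivative
         (\<Sum>l\<in>J. pdiff 1 l (pdiff 1 n F) (W t) * (\<gamma> t l * d l)) * (\<gamma> t n * d n)
        + pdiff 1 n F (W t) * (\<gamma> t n * d n * d n)) (at t)"
        by (rule derivative_eq_intros pd[OF n] \<gamma> refl)+ (simp add: algebra_simps)
    qed
  qed
  have "g' 0 \<le> g' t" if "t \<ge> 0" for t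
    by (rule DERIV_nonneg_imp_nondecreasing[OF that]) (use g' assms(4) in blast)
  moreover have "g' 0 = 0"
    using assms(7) by (simp add: g'_def W_def \<gamma>_def)
  ultimately have g'_nonneg: "g' t \<ge> 0" if "t \<ge> 0" for t
    using that by simp
  have "F (W 0) \<le> F (W 1)"
  proof (rule DERIV_nonneg_imp_nondecreasing[of 0 1 "\<lambda>t. F (W t)"])
    show "\<exists>y. ((\<lambda>t. F (W t)) has_real_derivative y) (at t) \<and> 0 \<le> y" if "0 \<le> t" for t
      using g[of t] g'_nonneg[OF that] by blast
  qed simp
  thus ?thesis by (simp add: W_def \<gamma>_def)
qed

text \<open>Here \<open>a\<close> is the geometric mean of the \<open>r j\<close> with \<open>j \<in> B\<close>. At a point whose coordinates in \<open>B\<close>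
  agree, the partial derivatives in these coordinates agree by symmetry, so that the tangent in a
  direction with logarithmic components of sum \<open>0\<close> is horizontal.\<close>

lemma symmetric_toric_psh_geometric_mean:
  fixes F :: "(nat \<Rightarrow> complex) \<Rightarrow> real" and r :: "nat \<Rightarrow> real"
  assumes "finite B" "Cr 2 B F" "toric B F" "\<And>w \<xi>. levi B F w \<xi> \<ge> 0"
    and sym: "\<And>w i j. i \<in> B \<Longrightarrow> j \<in> B \<Longrightarrow> F (swap_coord i j w) = F w"
    and "\<And>j. j \<in> B \<Longrightarrow> r j > 0" "a > 0" "(\<Sum>j\<in>B. ln (r j)) = real (card B) * ln a"
  shows "F (\<lambda>j. of_real (if j \<in> B then a else r j)) \<le> F (\<lambda>j. of_real (r j))"
proof -
  define s where "s = (\<lambda>j. if j \<in> B then a else r j)"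
  define d where "d = (\<lambda>j. if j \<in> B then ln (r j) - ln a else 0)"
  let ?w = "\<lambda>j. complex_of_real (s j)"
  have pd: "pdiff 1 i F ?w = pdiff 1 j F ?w" if "i \<in> B" "j \<in> B" for i j
  proof -
    have "swap_coord i j (?w(i := ?w i + of_real t * 1)) = ?w(j := ?w j + of_real t * 1)" for t
      using that by (auto simp: swap_coord_def fun_eq_iff Transposition.transpose_def s_def)
    hence "F (?w(i := ?w i + of_real t * 1)) = F (?w(j := ?w j + of_real t * 1))" for t
      using sym[OF that] by metis
    thus ?thesis unfolding pdiff_def by simp
  qed
  have sum_d: "(\<Sum>j\<in>B. d j) = 0"
    using assms(8) by (simp add: d_def sum_subtractf)
  have slope: "(\<Sum>j\<in>B. pdiff 1 j F ?w * (s j * d j)) = 0"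
  proof (cases "B = {}")
    case False
    then obtain i where i: "i \<in> B" by blast
    have "(\<Sum>j\<in>B. pdiff 1 j F ?w * (s j * d j)) = (\<Sum>j\<in>B. (pdiff 1 i F ?w * a) * d j)"
      using pd[OF i] by (intro sum.cong) (auto simp: s_def)
    thus ?thesis using sum_d by (simp flip: sum_distrib_left)
  qed simp
  have "(\<lambda>j. complex_of_real (s j * exp (d j))) = (\<lambda>j. of_real (r j))"
    using assms(6,7) by (auto simp: s_def d_def exp_diff)
  moreover have "F ?w \<le> F (\<lambda>j. of_real (s j * exp (d j)))"
    by (rule toric_psh_log_convex[OF assms(1-4) _ _ slope])
       (use assms(6,7) in \<open>auto simp: s_def d_def\<close>)
  ultimately show ?thesis by (simp add: s_def)
qed

section \<open>Kaehler potentials in the affine charts\<close>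

lemma sum_norm_update:
  fixes w :: "nat \<Rightarrow> complex"
  assumes "finite J" "n \<in> J"
  shows "(\<Sum>j\<in>J. (cmod ((w(n := w n + of_real t * c)) j))\<^sup>2)
       = (\<Sum>j\<in>J. (cmod (w j))\<^sup>2) + 2 * t * Re (cnj c * w n) + t\<^sup>2 * (cmod c)\<^sup>2"
proof -
  have "(cmod (w n + of_real t * c))\<^sup>2 = (cmod (w n))\<^sup>2 + 2 * t * Re (cnj c * w n) + t\<^sup>2 * (cmod c)\<^sup>2"
    unfolding cmod_power2 by (simp add: power2_eq_square algebra_simps)
  moreover have "(\<Sum>j\<in>J - {n}. (cmod ((w(n := w n + of_real t * c)) j))\<^sup>2) = (\<Sum>j\<in>J - {n}. (cmod (w j))\<^sup>2)"
    by (intro sum.cong) auto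
  ultimately show ?thesis
    using sum.remove[OF assms, of "\<lambda>j. (cmod ((w(n := w n + of_real t * c)) j))\<^sup>2"]
      sum.remove[OF assms, of "\<lambda>j. (cmod (w j))\<^sup>2"] by simp
qed

lemma Cr_2_ln_sum_norm:
  assumes "finite J"
  shows "Cr 2 J (\<lambda>w. ln (1 + (\<Sum>j\<in>J. (cmod (w j))\<^sup>2)))"
proof -
  define N where "N = (\<lambda>w::nat \<Rightarrow> complex. 1 + (\<Sum>j\<in>J. (cmod (w j))\<^sup>2))"
  have N_pos: "N w > 0" for w
    by (simp add: N_def add_pos_nonneg sum_nonneg)
  have dN: "((\<lambda>t. N (w(n := w n + of_real t * c))) has_real_derivative 2 * Re (cnj c * w n)) (at 0)"
    if "n \<in> J" for w n c
    unfolding N_def sum_norm_update[OF assms that]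
    by (auto intro!: derivative_eq_intros)
  have cont_coord: "continuous_on UNIV (\<lambda>w::nat \<Rightarrow> complex. w j)" for j
    by (rule continuous_on_product_coordinates)
  have cont_N: "continuous_on UNIV N"
    unfolding N_def by (intro continuous_intros cont_coord)
  have d1: "((\<lambda>t. ln (N (w(n := w n + of_real t * c)))) has_real_derivative 2 * Re (cnj c * w n) / N w) (at 0)"
    if "n \<in> J" for w n c
    using dN[OF that, of w c] N_pos[of w] by (auto intro!: derivative_eq_intros simp: divide_simps)
  have p1: "pdiff c n (\<lambda>w. ln (N w)) = (\<lambda>w. 2 * Re (cnj c * w n) / N w)" if "n \<in> J" for n c
    using d1[OF that] by (intro ext pdiff_eqI) (simp add: has_real_derivative_iff_has_vector_derivative)
  \<comment> \<open>The derivative of \<open>Re (cnj c * w n)\<close> in the \<open>l\<close>-th variable, in the direction \<open>e\<close>.\<close>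
  define \<kappa> where "\<kappa> = (\<lambda>(l::nat) n c e. if l = n then Re (cnj c * e) else 0)"
  have d2: "((\<lambda>t. 2 * Re (cnj c * (w(l := w l + of_real t * e)) n) / N (w(l := w l + of_real t * e)))
      has_real_derivative (2 * \<kappa> l n c e * N w - 2 * Re (cnj c * w n) * (2 * Re (cnj e * w l))) / (N w * N w)) (at 0)"
    if "l \<in> J" for w l n c e
  proof -
    have *: "Re (cnj c * (w(l := w l + of_real t * e)) n) = Re (cnj c * w n) + t * \<kappa> l n c e" for t
      by (auto simp: \<kappa>_def algebra_simps)
    show ?thesis
      unfolding *
      by (rule derivative_eq_intros dN[OF that] refl)+ (use N_pos[of w] in auto)
  qed
  have p2: "pdiff e l (\<lambda>w. 2 * Re (cnj c * w n) / N w)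
      = (\<lambda>w. (2 * \<kappa> l n c e * N w - 2 * Re (cnj c * w n) * (2 * Re (cnj e * w l))) / (N w * N w))"
    if "l \<in> J" for l n c e
    using d2[OF that] by (intro ext pdiff_eqI) (simp add: has_real_derivative_iff_has_vector_derivative)
  have N0: "N w \<noteq> 0" for w using N_pos[of w] by simp
  have cont: "continuous_on UNIV (\<lambda>w. ln (N w))"
    "continuous_on UNIV (\<lambda>w. 2 * Re (cnj c * w n) / N w)"
    "continuous_on UNIV (\<lambda>w. (2 * \<kappa> l n c e * N w - 2 * Re (cnj c * w n) * (2 * Re (cnj e * w l))) / (N w * N w))"
    for c n l e
    by (intro continuous_intros cont_N cont_coord; simp add: N0)+
  have "Cr (Suc (Suc 0)) J (\<lambda>w. ln (N w))"
    unfolding Cr.simps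
  proof (intro conjI ballI allI)
    fix n c w assume n: "n \<in> J"
    show "(\<lambda>t. ln (N (w(n := w n + of_real t * c)))) differentiable at 0"
      using d1[OF n] unfolding real_differentiable_def by blast
    show "continuous_on UNIV (pdiff c n (\<lambda>w. ln (N w)))"
      unfolding p1[OF n] by (rule cont)
    fix l e assume l: "l \<in> J"
    show "(\<lambda>t. pdiff c n (\<lambda>w. ln (N w)) (w(l := w l + of_real t * e))) differentiable at 0"
      unfolding p1[OF n] using d2[OF l] unfolding real_differentiable_def by blast
    show "continuous_on UNIV (pdiff e l (pdiff c n (\<lambda>w. ln (N w))))"
      unfolding p1[OF n] p2[OF l] by (rule cont)
  qed (rule cont)
  thus ?thesis by (simp add: N_def numeral_2_eq_2)
qed

text \<open>A Kaehler potential, in the chart \<open>{z\<^sub>i \<noteq> 0}\<close>, of the metric \<open>g + \<partial>\<partial>\<close>-bar \<open>\<phi>\<close>; its Levi form is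
  the matrix in the definition of admissibility.\<close>

definition chart_potential :: "nat \<Rightarrow> ((nat \<Rightarrow> complex) set \<Rightarrow> real) \<Rightarrow> nat \<Rightarrow> (nat \<Rightarrow> complex) \<Rightarrow> real" where
  "chart_potential m \<phi> i w =
     real (m + 1) * ln (1 + (\<Sum>j\<in>{..m} - {i}. (cmod (w j))\<^sup>2)) + \<phi> (chart_pt m i w)"

lemma chart_potential_cong:
  assumes "\<And>j. j \<in> {..m} - {i} \<Longrightarrow> w j = v j"
  shows "chart_potential m \<phi> i w = chart_potential m \<phi> i v"
proof -
  have "(\<lambda>j. if j = i then 1 else if j \<le> m then w j else 0) = (\<lambda>j. if j = i then 1 else if j \<le> m then v j else 0)"
    using assms by auto
  hence "chart_pt m i w = chart_pt m i v"
    unfolding chart_pt_def by simp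
  thus ?thesis using assms by (simp add: chart_potential_def)
qed

lemma Cr_2_chart_potential:
  assumes "g_admissible m \<phi>" "i \<le> m"
  shows "Cr 2 ({..m} - {i}) (chart_potential m \<phi> i)"
  unfolding chart_potential_def
  using assms by (intro Cr_linear Cr_2_ln_sum_norm) (auto simp: g_admissible_def smooth_on_CP_def)

lemma levi_chart_potential_nonneg:
  assumes "g_admissible m \<phi>" "i \<le> m"
  shows "levi ({..m} - {i}) (chart_potential m \<phi> i) w \<xi> \<ge> 0"
proof (cases "\<exists>l\<in>{..m} - {i}. \<xi> l \<noteq> 0")
  case False
  thus ?thesis by (simp add: levi_def)
next
  case True
  define J where "J = {..m} - {i}"
  define L where "L = (\<lambda>w::nat \<Rightarrow> complex. ln (1 + (\<Sum>j\<in>J. (cmod (w j))\<^sup>2)))"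
  define P where "P = (\<lambda>w. \<phi> (chart_pt m i w))"
  have L2: "Cr 2 J L" unfolding L_def by (rule Cr_2_ln_sum_norm) (simp add: J_def)
  have P2: "Cr 2 J P"
    using assms by (auto simp: g_admissible_def smooth_on_CP_def P_def J_def)
  from L2 P2 have CL: "Cr (Suc (Suc 0)) J L" and CP: "Cr (Suc (Suc 0)) J P"
    by (simp_all add: numeral_2_eq_2)
  have U: "chart_potential m \<phi> i = (\<lambda>w. real (m + 1) * L w + P w)"
    by (simp add: chart_potential_def L_def P_def J_def fun_eq_iff)
  have pd: "pdiff c l (pdiff c n (chart_potential m \<phi> i)) w
      = real (m + 1) * pdiff c l (pdiff c n L) w + pdiff c l (pdiff c n P) w"
    if ln: "l \<in> J" "n \<in> J" and c: "c \<in> {1, \<i>}" for l n c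
  proof -
    have "pdiff c n (chart_potential m \<phi> i) = (\<lambda>w. real (m + 1) * pdiff c n L w + pdiff c n P w)"
      unfolding U
      using Cr_differentiable[OF CL ln(2) c] Cr_differentiable[OF CP ln(2) c]
      by (intro ext pdiff_linear) auto
    thus ?thesis
      using Cr_differentiable[OF Cr_pdiff[OF CL ln(2) c] ln(1) c]
        Cr_differentiable[OF Cr_pdiff[OF CP ln(2) c] ln(1) c]
      by (simp add: pdiff_linear)
  qed
  let ?A = "\<lambda>l n. g_comp m i l n w + ddbar l n P w"
  have Re_A: "Re (?A l n) = (pdiff 1 l (pdiff 1 n (chart_potential m \<phi> i)) w
      + pdiff \<i> l (pdiff \<i> n (chart_potential m \<phi> i)) w) / 4" if "l \<in> J" "n \<in> J" for l n
  proof -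
    have "g_comp m i l n w = of_real (real (m + 1)) * ddbar l n L w"
      by (simp add: g_comp_def L_def J_def)
    hence "Re (g_comp m i l n w) = real (m + 1) * Re (ddbar l n L w)"
      by (simp only: times_complex.sel Re_complex_of_real Im_complex_of_real mult_zero_left diff_zero)
    thus ?thesis
      using pd[OF that, of 1] pd[OF that, of \<i>]
      by (simp add: Re_ddbar[OF L2 that] Re_ddbar[OF P2 that] field_simps)
  qed
  have "hermitian_pos_def J ?A"
    using assms unfolding g_admissible_def J_def P_def by blast
  hence "(\<exists>l\<in>J. v l \<noteq> 0) \<longrightarrow> Re (\<Sum>l\<in>J. \<Sum>n\<in>J. ?A l n * v l * cnj (v n)) > 0" for v
    unfolding hermitian_pos_def_def by blast
  from this[of "\<lambda>l. of_real (\<xi> l)"]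
  have "Re (\<Sum>l\<in>J. \<Sum>n\<in>J. ?A l n * of_real (\<xi> l) * cnj (of_real (\<xi> n))) > 0"
    using True by (simp add: J_def)
  also have "Re (\<Sum>l\<in>J. \<Sum>n\<in>J. ?A l n * of_real (\<xi> l) * cnj (of_real (\<xi> n)))
      = (\<Sum>l\<in>J. \<Sum>n\<in>J. Re (?A l n) * \<xi> l * \<xi> n)"
    by (simp only: Re_sum complex_cnj_complex_of_real) simp
  also have "\<dots> = levi J (chart_potential m \<phi> i) w \<xi> / 4"
    unfolding levi_def sum_divide_distrib
  proof (intro sum.cong refl)
    fix l n assume "l \<in> J" "n \<in> J"
    thus "Re (?A l n) * \<xi> l * \<xi> n = (pdiff 1 l (pdiff 1 n (chart_potential m \<phi> i)) w
      + pdiff \<i> l (pdiff \<i> n (chart_potential m \<phi> i)) w) * \<xi> l * \<xi> n / 4"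
      by (subst Re_A) auto
  qed
  finally show ?thesis by (simp add: J_def)
qed

section \<open>Invariance under the group\<close>

lemma G_invariant_generator:
  assumes "G_invariant m k \<phi>" "on_CP m f \<in> G_generators m k"
    and "z \<in> hvec m" "f z \<in> hvec m" "\<And>c. f (\<lambda>i. c * z i) = (\<lambda>i. c * f z i)"
  shows "\<phi> (hpoint m (f z)) = \<phi> (hpoint m z)"
proof -
  have "hpoint m z \<in> CP m" using assms(3) by (simp add: CP_eq)
  moreover have "on_CP m f \<in> G_grp m k"
    unfolding G_grp_def by (rule generate.incl[OF assms(2)])
  ultimately have "\<phi> (on_CP m f (hpoint m z)) = \<phi> (hpoint m z)"
    using assms(1) unfolding G_invariant_def by blast
  moreover have "on_CP m f (hpoint m z) = hpoint m (f z)"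
    using \<open>hpoint m z \<in> CP m\<close> image_hpoint[OF assms(3,4,5)] by (simp add: on_CP_def)
  ultimately show ?thesis by simp
qed

lemma G_invariant_abs_coord:
  assumes "G_invariant m k \<phi>" "z \<in> hvec m" "l \<le> m"
  shows "\<phi> (hpoint m (z(l := of_real (cmod (z l))))) = \<phi> (hpoint m z)"
proof -
  define v where "v = z(l := complex_of_real (cmod (z l)))"
  define \<theta> where "\<theta> = Arg2pi (z l)"
  have "z l = of_real (cmod (z l)) * exp (\<i> * of_real \<theta>)"
    unfolding \<theta>_def by (rule Arg2pi_eq)
  hence z: "rot_coord l \<theta> v = z"
    by (auto simp: rot_coord_def v_def)
  obtain j where "j \<le> m" "z j \<noteq> 0" using assms(2) by (auto simp: hvec_def)
  hence "v \<in> hvec m"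
    using assms(2,3) by (auto simp: hvec_def v_def intro!: exI[of _ j])
  moreover have "on_CP m (rot_coord l \<theta>) \<in> G_generators m k"
  proof -
    have "l \<in> {0..m}" "\<theta> \<in> {0..2*pi}"
      using assms(3) Arg2pi_ge_0[of "z l"] Arg2pi_lt_2pi[of "z l"] by (auto simp: \<theta>_def)
    thus ?thesis unfolding G_generators_def by blast
  qed
  moreover have "rot_coord l \<theta> v \<in> hvec m" using z assms(2) by simp
  moreover have "rot_coord l \<theta> (\<lambda>i. c * v i) = (\<lambda>i. c * rot_coord l \<theta> v i)" for c
    by (auto simp: rot_coord_def)
  ultimately have "\<phi> (hpoint m (rot_coord l \<theta> v)) = \<phi> (hpoint m v)"
    by (intro G_invariant_generator[OF assms(1)])
  thus ?thesis unfolding z unfolding v_def by (rule sym)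
qed

text \<open>The vector of \<open>\<complex>\<^sup>m\<^sup>+\<^sup>1\<close> with the real coordinates \<open>x 0, \<dots>, x m\<close>.\<close>

definition real_vec :: "nat \<Rightarrow> (nat \<Rightarrow> real) \<Rightarrow> nat \<Rightarrow> complex" where
  "real_vec m x = (\<lambda>j. if j \<le> m then of_real (x j) else 0)"

lemma G_invariant_abs:
  assumes "G_invariant m k \<phi>" "z \<in> hvec m"
  shows "\<phi> (hpoint m (real_vec m (\<lambda>j. cmod (z j)))) = \<phi> (hpoint m z)"
proof -
  let ?v = "\<lambda>K j. if j \<in> K then complex_of_real (cmod (z j)) else z j"
  obtain i where i: "i \<le> m" "z i \<noteq> 0" using assms(2) by (auto simp: hvec_def)
  have "\<phi> (hpoint m (?v K)) = \<phi> (hpoint m z)" if "K \<subseteq> {..m}" for K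
    using finite_subset[OF that finite_atMost] that
  proof (induction K rule: finite_induct)
    case (insert l K)
    have "?v K \<in> hvec m"
      using assms(2) i by (auto simp: hvec_def intro!: exI[of _ i])
    moreover have "(?v K)(l := of_real (cmod (?v K l))) = ?v (insert l K)"
      using insert.hyps by auto
    ultimately show ?case
      using G_invariant_abs_coord[OF assms(1), of "?v K" l] insert by simp
  qed simp
  moreover have "?v {..m} = real_vec m (\<lambda>j. cmod (z j))"
    using assms(2) by (auto simp: real_vec_def hvec_def)
  ultimately show ?thesis by (metis order_refl)
qed

lemma toric_chart_potential:
  assumes "G_invariant m k \<phi>" "i \<le> m"
  shows "toric ({..m} - {i}) (chart_potential m \<phi> i)"
  unfolding toric_def
proof (intro ballI allI)
  fix l w assume l: "l \<in> {..m} - {i}"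
  let ?v = "w(l := of_real (cmod (w l)))"
  define z where "z = (\<lambda>j. if j = i then 1 else if j \<le> m then w j else 0)"
  have "z \<in> hvec m" using assms(2) by (auto simp: z_def hvec_def)
  hence "\<phi> (hpoint m (z(l := of_real (cmod (z l))))) = \<phi> (hpoint m z)"
    using assms(1) l by (intro G_invariant_abs_coord) auto
  moreover have "z(l := of_real (cmod (z l))) = (\<lambda>j. if j = i then 1 else if j \<le> m then ?v j else 0)"
    using l by (auto simp: z_def)
  ultimately have "\<phi> (chart_pt m i ?v) = \<phi> (chart_pt m i w)"
    by (simp add: chart_pt_def z_def)
  moreover have "(\<Sum>j\<in>{..m} - {i}. (cmod (?v j))\<^sup>2) = (\<Sum>j\<in>{..m} - {i}. (cmod (w j))\<^sup>2)"
    by (intro sum.cong) auto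
  ultimately show "chart_potential m \<phi> i ?v = chart_potential m \<phi> i w"
    by (simp add: chart_potential_def)
qed

lemma chart_potential_swap:
  assumes "G_invariant m k \<phi>" "i \<le> m" "k < m"
    and "B = {0..k} \<or> B = {k+1..m}" "i \<notin> B" "p \<in> B" "q \<in> B"
  shows "chart_potential m \<phi> i (swap_coord p q w) = chart_potential m \<phi> i w"
proof -
  have pq: "p \<in> {..m} - {i}" "q \<in> {..m} - {i}" using assms by auto
  define z where "z = (\<lambda>j. if j = i then 1 else if j \<le> m then w j else 0)"
  have zh: "z \<in> hvec m" using assms(2) by (auto simp: z_def hvec_def)
  have swap: "swap_coord p q z = (\<lambda>j. if j = i then 1 else if j \<le> m then swap_coord p q w j else 0)"
    using pq by (auto simp: z_def swap_coord_def Transposition.transpose_def fun_eq_iff)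
  hence "swap_coord p q z \<in> hvec m" using assms(2) by (auto simp: hvec_def)
  moreover have "on_CP m (swap_coord p q) \<in> G_generators m k"
    using assms(4,6,7) unfolding G_generators_def by blast
  ultimately have "\<phi> (hpoint m (swap_coord p q z)) = \<phi> (hpoint m z)"
    by (intro G_invariant_generator[where f = "swap_coord p q", OF assms(1) _ zh]) (auto simp: swap_coord_def o_def fun_eq_iff)
  hence "\<phi> (chart_pt m i (swap_coord p q w)) = \<phi> (chart_pt m i w)"
    by (simp add: chart_pt_def z_def flip: swap)
  moreover have "(\<Sum>j\<in>{..m} - {i}. (cmod (swap_coord p q w j))\<^sup>2) = (\<Sum>j\<in>{..m} - {i}. (cmod (w j))\<^sup>2)"
  proof -
    have "bij_betw (Transposition.transpose p q) ({..m} - {i}) ({..m} - {i})"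
      using pq by (intro bij_betw_byWitness[where f' = "Transposition.transpose p q"])
        (auto simp: Transposition.transpose_def)
    from sum.reindex_bij_betw[OF this, of "\<lambda>j. (cmod (w j))\<^sup>2"] show ?thesis
      by (simp add: swap_coord_def)
  qed
  ultimately show ?thesis by (simp add: chart_potential_def)
qed

lemma chart_potential_mono:
  assumes "g_admissible m \<phi>" "G_invariant m k \<phi>" "i \<le> m"
    and "\<And>j. j \<in> {..m} - {i} \<Longrightarrow> 0 \<le> x j \<and> x j \<le> y j"
  shows "chart_potential m \<phi> i (\<lambda>j. of_real (x j)) \<le> chart_potential m \<phi> i (\<lambda>j. of_real (y j))"
proof -
  \<comment> \<open>The chart potential ignores the entries outside the affine coordinates; they are made equal.\<close>
  let ?y = "\<lambda>j. if j \<in> {..m} - {i} then y j else x j"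
  have "chart_potential m \<phi> i (\<lambda>j. of_real (x j)) \<le> chart_potential m \<phi> i (\<lambda>j. of_real (?y j))"
    using assms
    by (intro toric_psh_mono[of "{..m} - {i}"] Cr_2_chart_potential toric_chart_potential
        levi_chart_potential_nonneg) auto
  also have "\<dots> = chart_potential m \<phi> i (\<lambda>j. of_real (y j))"
    by (rule chart_potential_cong) auto
  finally show ?thesis .
qed

section \<open>The potential in homogeneous coordinates\<close>

text \<open>The global potential \<open>(m+1) ln |z|\<^sup>2 + \<phi> [z]\<close> on \<open>\<complex>\<^sup>m\<^sup>+\<^sup>1 - {0}\<close>, at real points \<open>z = x\<close>.\<close>

definition hom_potential :: "nat \<Rightarrow> ((nat \<Rightarrow> complex) set \<Rightarrow> real) \<Rightarrow> (nat \<Rightarrow> real) \<Rightarrow> real" where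
  "hom_potential m \<phi> x = real (m + 1) * ln (\<Sum>j\<in>{..m}. (x j)\<^sup>2) + \<phi> (hpoint m (real_vec m x))"

lemma hpoint_scale:
  assumes "z \<in> hvec m" "c \<noteq> 0"
  shows "hpoint m (\<lambda>i. c * z i) = hpoint m z"
proof -
  have "(z, \<lambda>i. c * z i) \<in> proj_rel m"
    using assms scale_hvec[OF assms] by (auto simp: proj_rel_def)
  thus ?thesis
    unfolding hpoint_def using equiv_class_eq[OF equiv_proj_rel] by metis
qed

text \<open>Logarithmic homogeneity of degree \<open>2 (m+1)\<close>: dividing by the \<open>i\<close>-th coordinate yields the potential
  of the \<open>i\<close>-th chart.\<close>

lemma hom_potential_chart:
  assumes "i \<le> m" "x i > 0"
  shows "hom_potential m \<phi> x
       = chart_potential m \<phi> i (\<lambda>j. of_real (x j / x i)) + 2 * real (m + 1) * ln (x i)"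
proof -
  define v where "v = (\<lambda>j. if j = i then 1 else if j \<le> m then complex_of_real (x j / x i) else 0)"
  have "v \<in> hvec m" using assms by (auto simp: v_def hvec_def)
  moreover have "real_vec m x = (\<lambda>j. of_real (x i) * v j)"
    using assms by (auto simp: v_def real_vec_def)
  ultimately have pt: "hpoint m (real_vec m x) = chart_pt m i (\<lambda>j. of_real (x j / x i))"
    using assms(2) hpoint_scale[of v m "of_real (x i)"]
    unfolding chart_pt_def v_def[symmetric] by simp
  let ?S = "1 + (\<Sum>j\<in>{..m} - {i}. (cmod (of_real (x j / x i)))\<^sup>2)"
  have "(\<Sum>j\<in>{..m}. (x j)\<^sup>2) = (x i)\<^sup>2 + (\<Sum>j\<in>{..m} - {i}. (x j)\<^sup>2)"
    using assms(1) by (intro sum.remove) auto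
  also have "\<dots> = (x i)\<^sup>2 * ?S"
    using assms(2) by (simp add: ring_distribs sum_distrib_left norm_divide power_divide)
  finally have "ln (\<Sum>j\<in>{..m}. (x j)\<^sup>2) = ln ((x i)\<^sup>2 * ?S)" by simp
  also have "\<dots> = ln ((x i)\<^sup>2) + ln ?S"
    using assms(2) by (intro ln_mult_pos add_pos_nonneg sum_nonneg) auto
  also have "ln ((x i)\<^sup>2) = 2 * ln (x i)"
    using assms(2) by (simp add: ln_realpow)
  finally show ?thesis
    unfolding hom_potential_def chart_potential_def pt by (simp add: algebra_simps)
qed

text \<open>In the chart of a smallest coordinate, all coordinates are at least \<open>1\<close>, and monotonicity allows
  lowering them to \<open>1\<close>.\<close>

lemma hom_potential_ge_one:
  assumes "g_admissible m \<phi>" "G_invariant m k \<phi>" "i \<le> m" "x i > 0"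
    and "\<And>j. j \<le> m \<Longrightarrow> x i \<le> x j"
  shows "hom_potential m \<phi> (\<lambda>_. 1) + 2 * real (m + 1) * ln (x i) \<le> hom_potential m \<phi> x"
proof -
  have "chart_potential m \<phi> i (\<lambda>j. of_real 1) \<le> chart_potential m \<phi> i (\<lambda>j. of_real (x j / x i))"
    using assms by (intro chart_potential_mono[OF assms(1-3)]) auto
  thus ?thesis
    using hom_potential_chart[OF assms(3), of "\<lambda>_. 1" \<phi>] hom_potential_chart[of i m x \<phi>] assms(3,4) by simp
qed

text \<open>In the chart of a largest coordinate, all absolute values are at most \<open>1\<close>, and monotonicity allows
  raising them to \<open>1\<close>.\<close>

lemma admissible_le_hom_potential_one:
  assumes "g_admissible m \<phi>" "G_invariant m k \<phi>" "p \<in> CP m"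
  shows "\<phi> p \<le> hom_potential m \<phi> (\<lambda>_. 1)"
proof -
  obtain z where z: "z \<in> hvec m" "p = hpoint m z"
    using assms(3) by (auto simp: CP_eq)
  define x where "x = (\<lambda>j. cmod (z j))"
  have "Max (x ` {..m}) \<in> x ` {..m}" by (intro Max_in) auto
  then obtain i where i: "i \<le> m" "x i = Max (x ` {..m})" unfolding image_iff by force
  have i_max: "x j \<le> x i" if "j \<le> m" for j
    unfolding i(2) using that by (intro Max_ge) auto
  obtain j where "j \<le> m" "z j \<noteq> 0" using z(1) by (auto simp: hvec_def)
  hence xi: "x i > 0" using i_max[of j] by (auto simp: x_def)
  have "chart_potential m \<phi> i (\<lambda>j. of_real (x j / x i)) \<le> chart_potential m \<phi> i (\<lambda>j. of_real 1)"
    using i_max xi by (intro chart_potential_mono[OF assms(1,2) i(1)]) (auto simp: x_def)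
  hence "hom_potential m \<phi> x \<le> hom_potential m \<phi> (\<lambda>_. 1) + real (m + 1) * (2 * ln (x i))"
    using hom_potential_chart[of i m "\<lambda>_. 1" \<phi>] hom_potential_chart[of i m x \<phi>] i(1) xi
    by (simp add: algebra_simps)
  also have "hom_potential m \<phi> x = real (m + 1) * ln (\<Sum>j\<in>{..m}. (x j)\<^sup>2) + \<phi> p"
    using G_invariant_abs[OF assms(2) z(1)] by (simp add: hom_potential_def z(2) x_def)
  finally have le: "real (m + 1) * ln (\<Sum>j\<in>{..m}. (x j)\<^sup>2) + \<phi> p
      \<le> hom_potential m \<phi> (\<lambda>_. 1) + real (m + 1) * (2 * ln (x i))" .
  have "2 * ln (x i) = ln ((x i)\<^sup>2)" using xi by (simp add: ln_realpow)
  also have "\<dots> \<le> ln (\<Sum>j\<in>{..m}. (x j)\<^sup>2)"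
  proof -
    have "(x i)\<^sup>2 \<le> (\<Sum>j\<in>{..m}. (x j)\<^sup>2)"
      using i(1) by (intro member_le_sum) auto
    thus ?thesis using xi by (intro ln_mono) auto
  qed
  finally have "real (m + 1) * (2 * ln (x i)) \<le> real (m + 1) * ln (\<Sum>j\<in>{..m}. (x j)\<^sup>2)"
    by (intro mult_left_mono) auto
  with le show ?thesis by linarith
qed

text \<open>A chart \<open>{z\<^sub>i \<noteq> 0}\<close> with \<open>i\<close> outside the block \<open>B\<close> has all coordinates of \<open>B\<close> among its affine
  coordinates, and the permutations of \<open>B\<close> act on it by permuting them.\<close>

lemma hom_potential_geometric_mean:
  assumes "g_admissible m \<phi>" "G_invariant m k \<phi>" "k < m" "B = {0..k} \<or> B = {k+1..m}"
    and "\<And>j. j \<le> m \<Longrightarrow> x j > 0" "a > 0" "(\<Sum>j\<in>B. ln (x j)) = real (card B) * ln a"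
  shows "hom_potential m \<phi> (\<lambda>j. if j \<in> B then a else x j) \<le> hom_potential m \<phi> x"
proof -
  define i where "i = (if B = {0..k} then m else 0)"
  have i: "i \<le> m" "i \<notin> B" using assms(3,4) by (auto simp: i_def)
  have B: "B \<subseteq> {..m} - {i}" using assms(3,4) i by auto
  hence fin: "finite B" by (rule finite_subset) simp
  have xi: "x i > 0" using assms(5) i by simp
  define U where "U = chart_potential m \<phi> i"
  have "U (\<lambda>j. of_real (if j \<in> B then a / x i else x j / x i)) \<le> U (\<lambda>j. of_real (x j / x i))"
  proof (rule symmetric_toric_psh_geometric_mean[OF fin])
    show "Cr 2 B U"
      unfolding U_def using Cr_2_chart_potential[OF assms(1) i(1)] B by (rule Cr_subset)
    show "toric B U"
      using toric_chart_potential[OF assms(2) i(1)] B by (auto simp: toric_def U_def)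
    show "levi B U w \<xi> \<ge> 0" for w \<xi>
      unfolding U_def
      by (rule levi_nonneg_subset[OF _ B levi_chart_potential_nonneg[OF assms(1) i(1)]]) simp
    show "U (swap_coord p q w) = U w" if "p \<in> B" "q \<in> B" for w p q
      unfolding U_def by (rule chart_potential_swap[OF assms(2) i(1) assms(3,4) i(2) that])
    show "x j / x i > 0" if "j \<in> B" for j using that B assms(5)[of j] xi by auto
    show "a / x i > 0" using assms(6) xi by simp
    have "(\<Sum>j\<in>B. ln (x j / x i)) = (\<Sum>j\<in>B. ln (x j) - ln (x i))"
    proof (intro sum.cong refl)
      fix j assume "j \<in> B"
      thus "ln (x j / x i) = ln (x j) - ln (x i)" using B assms(5)[of j] xi by (auto simp: ln_divide_pos)
    qed
    thus "(\<Sum>j\<in>B. ln (x j / x i)) = real (card B) * ln (a / x i)"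
      using assms(6,7) xi by (simp add: sum_subtractf ln_div algebra_simps)
  qed
  moreover have "(\<lambda>j. complex_of_real (if j \<in> B then a / x i else x j / x i))
     = (\<lambda>j. of_real ((if j \<in> B then a else x j) / x i))" by auto
  ultimately show ?thesis
    using hom_potential_chart[OF i(1), of x \<phi>] i xi
      hom_potential_chart[OF i(1), of "\<lambda>j. if j \<in> B then a else x j" \<phi>]
    by (simp add: U_def)
qed

section \<open>The lower bound\<close>

lemma ln_ext_quotient:
  assumes "finite B" "B \<noteq> {}" "\<And>j. j \<in> B \<Longrightarrow> x j > 0" "S > 0"
  shows "ln_ext ((\<Prod>j\<in>B. x j) powr (2 * c / real (card B)) / S ^ n)
       = ereal (2 * c * ((\<Sum>j\<in>B. ln (x j)) / real (card B)) - real n * ln S)"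
proof -
  have P: "(\<Prod>j\<in>B. x j) > 0" using assms(3) by (rule prod_pos)
  have "ln (\<Prod>j\<in>B. x j) = (\<Sum>j\<in>B. ln (x j))"
    using assms(1) by (rule ln_prod) (use assms(3) in force)
  thus ?thesis
    using P assms(4) by (simp add: ln_ext_def ln_div ln_powr ln_realpow)
qed

theorem mainTheorem1:
  fixes m k :: nat and \<phi> :: "(nat \<Rightarrow> complex) set \<Rightarrow> real"
  assumes "m \<ge> 2" and "k \<in> {1..m - 1}"
    and "smooth_on_CP m \<phi>"
    and "g_admissible m \<phi>"
    and "G_invariant m k \<phi>"
    and "(SUP p\<in>CP m. \<phi> p) = 0"
  shows "\<forall>p\<in>CP m. ereal (\<phi> p) \<ge> psi m k p"
proof
  fix p assume "p \<in> CP m"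
  then obtain z where z: "z \<in> hvec m" "p = hpoint m z" by (auto simp: CP_eq)
  have k: "k < m" using assms(1,2) by auto
  let ?B1 = "{0..k}" and ?B2 = "{k+1..m}"
  have psi: "psi m k p = inf (psi1_hom m k z) (psi2_hom m k z)"
    unfolding z(2) by (rule psi_hpoint[OF z(1) k])
  show "psi m k p \<le> ereal (\<phi> p)"
  proof (cases "\<exists>j\<le>m. z j = 0")
    case True
    then obtain j where j: "j \<le> m" "z j = 0" by blast
    show ?thesis
    proof (cases "j \<le> k")
      case True
      hence "(\<Prod>i\<in>?B1. cmod (z i)) = 0" using j by auto
      hence "psi1_hom m k z = - \<infinity>" by (simp add: psi1_hom_def ln_ext_def)
      thus ?thesis by (simp add: psi)
    next
      case False
      hence "(\<Prod>i\<in>?B2. cmod (z i)) = 0" using j by auto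
      hence "psi2_hom m k z = - \<infinity>" by (simp add: psi2_hom_def ln_ext_def)
      thus ?thesis by (simp add: psi)
    qed
  next
    case False
    define x where "x = (\<lambda>j. cmod (z j))"
    have x: "x j > 0" if "j \<le> m" for j using False that by (simp add: x_def)
    define S where "S = (\<Sum>j\<in>{0..m}. (x j)\<^sup>2)"
    have S: "S > 0" unfolding S_def by (intro sum_pos) (use x in force)+
    \<comment> \<open>The logarithms of the geometric means of the two blocks.\<close>
    define \<alpha> where "\<alpha> = (\<Sum>j\<in>?B1. ln (x j)) / real (card ?B1)"
    define \<beta> where "\<beta> = (\<Sum>j\<in>?B2. ln (x j)) / real (card ?B2)"
    have psi1: "psi1_hom m k z = ereal (2 * real (m + 1) * \<alpha> - real (m + 1) * ln S)"
      using ln_ext_quotient[of ?B1 x S "real (m + 1)" "m + 1"] x k S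
      by (simp add: psi1_hom_def \<alpha>_def S_def x_def add.commute)
    have psi2: "psi2_hom m k z = ereal (2 * real (m + 1) * \<beta> - real (m + 1) * ln S)"
      using ln_ext_quotient[of ?B2 x S "real (m + 1)" "m + 1"] x k S
      by (simp add: psi2_hom_def \<beta>_def S_def x_def add.commute of_nat_diff)
    define x1 where "x1 = (\<lambda>j. if j \<in> ?B1 then exp \<alpha> else x j)"
    define x2 where "x2 = (\<lambda>j. if j \<in> ?B2 then exp \<beta> else x1 j)"
    have "hom_potential m \<phi> x1 \<le> hom_potential m \<phi> x"
      unfolding x1_def
      by (rule hom_potential_geometric_mean[OF assms(4,5) k]) (use x in \<open>auto simp: \<alpha>_def\<close>)
    moreover have "hom_potential m \<phi> x2 \<le> hom_potential m \<phi> x1"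
      unfolding x2_def
    proof (rule hom_potential_geometric_mean[OF assms(4,5) k])
      have "(\<Sum>j\<in>?B2. ln (x1 j)) = (\<Sum>j\<in>?B2. ln (x j))"
        by (intro sum.cong) (auto simp: x1_def)
      thus "(\<Sum>j\<in>?B2. ln (x1 j)) = real (card ?B2) * ln (exp \<beta>)"
        using k by (simp add: \<beta>_def)
    qed (use x in \<open>auto simp: x1_def\<close>)
    moreover have "hom_potential m \<phi> (\<lambda>_. 1) + 2 * real (m + 1) * min \<alpha> \<beta> \<le> hom_potential m \<phi> x2"
    proof -
      \<comment> \<open>An index in the block on which \<open>x2\<close> has its smaller value.\<close>
      define i where "i = (if \<alpha> \<le> \<beta> then 0 else m)"
      have "x2 i = exp (min \<alpha> \<beta>)" using k by (simp add: i_def x2_def x1_def)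
      moreover have "x2 j \<ge> exp (min \<alpha> \<beta>)" if "j \<le> m" for j
        using that by (auto simp: x2_def x1_def)
      moreover have "i \<le> m" by (simp add: i_def)
      ultimately show ?thesis
        using hom_potential_ge_one[OF assms(4,5), of i x2] by simp
    qed
    moreover have "hom_potential m \<phi> (\<lambda>_. 1) \<ge> 0"
    proof -
      have "(SUP p\<in>CP m. \<phi> p) \<le> hom_potential m \<phi> (\<lambda>_. 1)"
        by (rule cSUP_least[OF _ admissible_le_hom_potential_one[OF assms(4,5)]])
          (use \<open>p \<in> CP m\<close> in auto)
      thus ?thesis using assms(6) by simp
    qed
    moreover have "hom_potential m \<phi> x = real (m + 1) * ln S + \<phi> p"
      using G_invariant_abs[OF assms(5) z(1)]
      by (simp add: hom_potential_def S_def x_def z(2) atLeast0AtMost)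
    ultimately have "2 * real (m + 1) * min \<alpha> \<beta> - real (m + 1) * ln S \<le> \<phi> p" by linarith
    thus ?thesis
      unfolding psi psi1 psi2 by (cases "\<alpha> \<le> \<beta>") (auto simp: min_def inf_min)
  qed
qed

end
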